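(* Let $n=2$, let $F\in L^2_{loc}(\mathbb R^2)$, $z\in H^1_{loc}(\mathbb R^2)$, and let $f\in W^{1,\infty}(\mathbb S^1)$ with $\min_{\mathbb S^1}f>0$. With $\bar f,\bar h_f,\bar H_f$ and $J'(f)$ as defined in the context, assume that $\bar h_f\in L^\infty(0,2\pi)$ and $\bar H_f\in W^{1,\infty}_{per}(0,2\pi)$. Set $$c:=\frac{\int_0^{2\pi}\bar h_f\,\mathrm{d}\phi}{\int_0^{2\pi}\bar f\,\mathrm{d}\phi},\qquad q_f:=\bar h_f-\bar H_f'-c\bar f,\qquad G(\phi):=-\int_0^\phi q_f(t)\,\mathrm{d}t,$$ $$M(r):=|\{\phi\in[0,2\pi):G(\phi)<r\}|\ (r\in\mathbb R),\qquad \beta^*:=\sup\{r\in\mathbb R: M(r)\le\pi\},$$ $$O_+:=\{\phi\in[0,2\pi):G(\phi)>\beta^*\},\quad O_-:=\{\phi\in[0,2\pi):G(\phi)<\beta^*\},\quad O_0:=\{\phi\in[0,2\pi):G(\phi)=\beta^*\},$$ $$k:=0\ \text{ if }|O_0|=0,\qquad k:=\frac{|O_+|-|O_-|}{|O_0|}\ \text{ otherwise},$$ where $|\cdot|$ is Lebesgue measure, and define $$\bar g(\phi):=\int_0^\phi\big(\chi_{O_-}(t)-\chi_{O_+}(t)+k\,\chi_{O_0}(t)\big)\,\mathrm{d}t+\alpha,\qquad\phi\in[0,2\pi],$$ where $\alpha\in\mathbb R$ is chosen such that $\int_0^{2\pi}\bar g\,\bar f\,\mathrm{d}\phi=0$.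 Let $$V_\infty(f):=\Big\{v\in W^{1,\infty}_{per}(0,2\pi)\;:\;\int_0^{2\pi}\bar f\,v\,\mathrm{d}\phi=0,\ \|v'\|_{L^\infty(0,2\pi)}\le1\Big\}.$$ Then $\bar g\in V_\infty(f)$ and $$\langle J'(f),\bar g\rangle=\min_{v\in V_\infty(f)}\langle J'(f),v\rangle .$$
   Context: $W^{1,\infty}_{per}(0,2\pi)$ is the space of Lipschitz functions $v$ on $[0,2\pi]$ with $v(0)=v(2\pi)$; such $v$ is identified with the function on $\mathbb S^1$ taking the value $v(\phi)$ at $(\cos\phi,\sin\phi)^t$. For $f\in W^{1,\infty}(\mathbb S^1)$ (Lipschitz functions on the unit circle) write $\bar f(\phi)=f((\cos\phi,\sin\phi)^t)$; $\nabla_Tf$ is the tangential gradient, $\nabla_Tf((\cos\phi,\sin\phi)^t)=\bar f'(\phi)(-\sin\phi,\cos\phi)^t$. $\chi_A$ is the indicator function of $A$; $\omega_x:=x/|x|$ for $x\ne0$; $B$ is the open unit disc in $\mathbb R^2$. For positive $f$ let $\Omega_f:=\{x\in\mathbb R^2: x=0\text{ or }|x|<f(\omega_x),\ x\neq 0\}$ and $J(f):=\frac12\int_{\Omega_f}|u-z|^2\,\mathrm{d}x$, where $u\in H^1_0(\Omega_f)$ solves $\int_{\Omega_f}\nabla u\cdot\nabla\eta\,\mathrm{d}x=\int_{\Omega_f}F\eta\,\mathrm{d}x$ for all $\eta\in H^1_0(\Omega_f)$. Let $p\in H^1_0(\Omega_f)$ solve $\int_{\Omega_f}\nabla p\cdot\nabla\eta\,\mathrm{d}x=\int_{\Omega_f}(u-z)\eta\,\mathrm{d}x$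 for all $\eta\in H^1_0(\Omega_f)$. Let $\Phi_f(x):=f(\omega_x)x$ for $x\ne0$, $\Phi_f(0):=0$, which maps $B$ onto $\Omega_f$, and put $\hat u=u\circ\Phi_f$, $\hat p=p\circ\Phi_f$, $\hat z_f=z\circ\Phi_f$, $\hat F_f=F\circ\Phi_f$ on $B$. Define on $B$ (with $f,\nabla_Tf$ evaluated at $\omega_x$) $$h_f=\frac{2|\nabla_Tf|^2}{f^{3}}(\nabla\hat u\cdot\omega_x)(\nabla\hat p\cdot\omega_x)-\frac1{f^{2}}\big((\nabla_Tf\cdot\nabla\hat u)(\omega_x\cdot\nabla\hat p)+(\nabla_Tf\cdot\nabla\hat p)(\omega_x\cdot\nabla\hat u)\big)+f\big((\hat u-\hat z_f)^2-|x|(\hat u-\hat z_f)\nabla\hat z_f\cdot\omega_x-|x|\hat F_f\nabla\hat p\cdot\omega_x\big),$$ $$H_f=\frac1f\big((\nabla\hat p\cdot\omega_x)\nabla\hat u+(\nabla\hat u\cdot\omega_x)\nabla\hat p\big)-\frac2{f^{2}}(\nabla\hat u\cdot\omega_x)(\nabla\hat p\cdot\omega_x)\nabla_Tf,$$ and for $\omega\in\mathbb S^1$: $\tilde h_f(\omega)=\int_0^1 s\,h_f(s\omega)\,\mathrm{d}s$, $\tilde H_f(\omega)=\int_0^1 s\,H_f(s\omega)\,\mathrm{d}s$. Finally $\bar h_f(\phi)=\tilde h_f((\cos\phi,\sin\phi)^t)$ and $\bar H_f(\phi)=\tilde H_f((\cos\phi,\sin\phi)^t)\cdot(-\sin\phi,\cos\phi)^t$.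 $J'(f)$ is the Gateaux derivative of $J$ at $f$, which is given by $$\langle J'(f),v\rangle=\int_0^{2\pi}\big(\bar h_f(\phi)v(\phi)+\bar H_f(\phi)v'(\phi)\big)\,\mathrm{d}\phi,\qquad v\in W^{1,\infty}_{per}(0,2\pi).$$ *)

theory Defs
  imports "HOL-Analysis.Analysis" "HOL-Probability.Essential_Supremum"
begin

type_synonym plane = "real^2"

section \<open>Sobolev spaces on subsets of the plane\<close>

text \<open>
  Elements of Lebesgue and Sobolev spaces are represented by functions on the whole plane, of which
  only the values on the domain matter (up to null sets).
\<close>

definition L2_on :: "plane set \<Rightarrow> (plane \<Rightarrow> 'b::euclidean_space) \<Rightarrow> bool" where
  "L2_on U v \<longleftrightarrow> v \<in> borel_measurable (lebesgue_on U)
     \<and> integrable (lebesgue_on U) (\<lambda>x. (norm (v x))\<^sup>2)"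

definition L2_loc :: "(plane \<Rightarrow> 'b::euclidean_space) \<Rightarrow> bool" where
  "L2_loc v \<longleftrightarrow> (\<forall>K. compact K \<longrightarrow> L2_on K v)"

primrec C_k :: "nat \<Rightarrow> (plane \<Rightarrow> real) \<Rightarrow> bool" where
  "C_k 0 \<phi> \<longleftrightarrow> continuous_on UNIV \<phi>"
| "C_k (Suc k) \<phi> \<longleftrightarrow> (\<exists>D. (\<forall>x. GDERIV \<phi> x :> D x) \<and> (\<forall>i. C_k k (\<lambda>x. D x $ i)))"

definition test_function :: "plane set \<Rightarrow> (plane \<Rightarrow> real) \<Rightarrow> bool" where
  "test_function U \<phi> \<longleftrightarrow> (\<forall>k. C_k k \<phi>)
     \<and> compact (closure {x. \<phi> x \<noteq> 0}) \<and> closure {x. \<phi> x \<noteq> 0} \<subseteq> U"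

text \<open>The weak gradient is a relation, since it is determined only up to null sets.\<close>

definition weak_gradient :: "plane set \<Rightarrow> (plane \<Rightarrow> real) \<Rightarrow> (plane \<Rightarrow> plane) \<Rightarrow> bool" where
  "weak_gradient U v G \<longleftrightarrow>
     (\<forall>K. compact K \<and> K \<subseteq> U \<longrightarrow> integrable (lebesgue_on K) v \<and> integrable (lebesgue_on K) G)
     \<and> (\<forall>\<phi> D. test_function U \<phi> \<and> (\<forall>x. GDERIV \<phi> x :> D x) \<longrightarrow>
          (LINT x:U|lebesgue. v x *\<^sub>R D x) = - (LINT x:U|lebesgue. \<phi> x *\<^sub>R G x))"

definition H1_loc :: "(plane \<Rightarrow> real) \<Rightarrow> bool" where
  "H1_loc v \<longleftrightarrow> L2_loc v \<and> (\<exists>G. weak_gradient UNIV v G \<and> L2_loc G)"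

definition H1_0 :: "plane set \<Rightarrow> (plane \<Rightarrow> real) \<Rightarrow> bool" where
  "H1_0 U v \<longleftrightarrow> L2_on U v \<and> (\<exists>G. weak_gradient U v G \<and> L2_on U G
     \<and> (\<exists>\<phi> D. (\<forall>n. test_function U (\<phi> n) \<and> (\<forall>x. GDERIV (\<phi> n) x :> D n x))
          \<and> (\<lambda>n. LINT x:U|lebesgue. (\<phi> n x - v x)\<^sup>2) \<longlonglongrightarrow> 0
          \<and> (\<lambda>n. LINT x:U|lebesgue. (norm (D n x - G x))\<^sup>2) \<longlonglongrightarrow> 0))"

text \<open>Weak solution of the Poisson problem with right-hand side \<open>r\<close> and zero boundary values.\<close>

definition weak_solution :: "plane set \<Rightarrow> (plane \<Rightarrow> real) \<Rightarrow> (plane \<Rightarrow> real) \<Rightarrow> bool" where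
  "weak_solution U r w \<longleftrightarrow> H1_0 U w
     \<and> (\<forall>\<eta> Dw D\<eta>. weak_gradient U w Dw \<and> H1_0 U \<eta> \<and> weak_gradient U \<eta> D\<eta> \<longrightarrow>
          (LINT x:U|lebesgue. Dw x \<bullet> D\<eta> x) = (LINT x:U|lebesgue. r x * \<eta> x))"

section \<open>Functions on the circle\<close>

definition circ :: "real \<Rightarrow> plane" where
  "circ \<phi> = vector [cos \<phi>, sin \<phi>]"

definition tang :: "real \<Rightarrow> plane" where
  "tang \<phi> = vector [- sin \<phi>, cos \<phi>]"

definition angle :: "plane \<Rightarrow> real" where
  "angle x = Arg2pi (Complex (x $ 1) (x $ 2))"

definition on_angle :: "(plane \<Rightarrow> real) \<Rightarrow> real \<Rightarrow> real" where
  "on_angle f \<phi> = f (circ \<phi>)"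

definition on_circle :: "(real \<Rightarrow> real) \<Rightarrow> plane \<Rightarrow> real" where
  "on_circle v \<omega> = v (angle \<omega>)"

text \<open>
  Lipschitz functions are differentiable almost everywhere; on the exceptional null set \<open>deriv\<close>
  takes an unspecified value.
\<close>

definition tangential_gradient :: "(plane \<Rightarrow> real) \<Rightarrow> plane \<Rightarrow> plane" where
  "tangential_gradient f \<omega> = deriv (on_angle f) (angle \<omega>) *\<^sub>R tang (angle \<omega>)"

definition W1inf_circle :: "(plane \<Rightarrow> real) set" where
  "W1inf_circle = {f. \<exists>L. L-lipschitz_on (sphere 0 1) f}"

text \<open>Only the values on \<open>[0,2\<pi>]\<close> matter for membership in the following sets.\<close>

definition W1inf_per :: "(real \<Rightarrow> real) set" where
  "W1inf_per = {v. (\<exists>L. L-lipschitz_on {0..2*pi} v) \<and> v 0 = v (2*pi)}"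

definition Linf_norm :: "(real \<Rightarrow> real) \<Rightarrow> ereal" where
  "Linf_norm w = esssup (lebesgue_on {0<..<2*pi}) (\<lambda>\<phi>. ereal \<bar>w \<phi>\<bar>)"

definition Linf :: "(real \<Rightarrow> real) set" where
  "Linf = {w. w \<in> borel_measurable (lebesgue_on {0<..<2*pi}) \<and> Linf_norm w < \<infinity>}"

definition V_inf :: "(plane \<Rightarrow> real) \<Rightarrow> (real \<Rightarrow> real) set" where
  "V_inf f = {v \<in> W1inf_per. (LINT \<phi>:{0..2*pi}|lebesgue. on_angle f \<phi> * v \<phi>) = 0
     \<and> Linf_norm (deriv v) \<le> 1}"

section \<open>The shape functional and its derivative\<close>

text \<open>The direction \<open>x / |x|\<close> is \<open>sgn x\<close>.\<close>

definition Omega :: "(plane \<Rightarrow> real) \<Rightarrow> plane set" where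
  "Omega f = {x. x = 0 \<or> (x \<noteq> 0 \<and> norm x < f (sgn x))}"

definition Phi :: "(plane \<Rightarrow> real) \<Rightarrow> plane \<Rightarrow> plane" where
  "Phi f x = (if x = 0 then 0 else f (sgn x) *\<^sub>R x)"

text \<open>The state is unique up to null sets, so the described value is unique.\<close>

definition J :: "(plane \<Rightarrow> real) \<Rightarrow> (plane \<Rightarrow> real) \<Rightarrow> (plane \<Rightarrow> real) \<Rightarrow> real" where
  "J F z f = (THE r. \<exists>u. weak_solution (Omega f) F u
                \<and> r = 1/2 * (LINT x:Omega f|lebesgue. \<bar>u x - z x\<bar>\<^sup>2))"

text \<open>
  Gateaux derivative at \<open>f\<close> in \<open>W\<^sup>1\<^sup>,\<^sup>\<infinity>\<close> of the circle, in directions given as periodic functions of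
  the angle: the directional derivatives exist and form a linear functional that is bounded with
  respect to the sup norm plus the Lipschitz constant.
\<close>

definition has_gateaux_derivative ::
  "((plane \<Rightarrow> real) \<Rightarrow> real) \<Rightarrow> (plane \<Rightarrow> real) \<Rightarrow> ((real \<Rightarrow> real) \<Rightarrow> real) \<Rightarrow> bool" where
  "has_gateaux_derivative E f E' \<longleftrightarrow>
     (\<forall>v\<in>W1inf_per. ((\<lambda>t. (E (\<lambda>\<omega>. f \<omega> + t * on_circle v \<omega>) - E f) / t) \<longlongrightarrow> E' v) (at 0))
     \<and> (\<forall>v\<in>W1inf_per. \<forall>w\<in>W1inf_per. \<forall>a b. E' (\<lambda>\<phi>. a * v \<phi> + b * w \<phi>) = a * E' v + b * E' w)
     \<and> (\<exists>C. \<forall>v\<in>W1inf_per. \<forall>S L. (\<forall>\<phi>\<in>{0..2*pi}. \<bar>v \<phi>\<bar> \<le> S) \<and> L-lipschitz_on {0..2*pi} v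
           \<longrightarrow> \<bar>E' v\<bar> \<le> C * (S + L))"

text \<open>
  The densities below take the functions \<open>uh = u \<circ> \<Phi>\<^sub>f\<close>, \<open>zh = z \<circ> \<Phi>\<^sub>f\<close>, \<open>Fh = F \<circ> \<Phi>\<^sub>f\<close> on the unit disc and
  the weak gradients \<open>Du\<close>, \<open>Dp\<close>, \<open>Dz\<close> of \<open>u \<circ> \<Phi>\<^sub>f\<close>, \<open>p \<circ> \<Phi>\<^sub>f\<close>, \<open>z \<circ> \<Phi>\<^sub>f\<close> as arguments.
\<close>

definition h_density ::
  "(plane \<Rightarrow> real) \<Rightarrow> (plane \<Rightarrow> real) \<Rightarrow> (plane \<Rightarrow> real) \<Rightarrow> (plane \<Rightarrow> real)
    \<Rightarrow> (plane \<Rightarrow> plane) \<Rightarrow> (plane \<Rightarrow> plane) \<Rightarrow> (plane \<Rightarrow> plane) \<Rightarrow> plane \<Rightarrow> real" where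
  "h_density f Fh zh uh Du Dp Dz x =
     (let \<omega> = sgn x; a = f \<omega>; T = tangential_gradient f \<omega> in
       2 * (norm T)\<^sup>2 / a^3 * (Du x \<bullet> \<omega>) * (Dp x \<bullet> \<omega>)
       - 1 / a\<^sup>2 * ((T \<bullet> Du x) * (\<omega> \<bullet> Dp x) + (T \<bullet> Dp x) * (\<omega> \<bullet> Du x))
       + a * ((uh x - zh x)\<^sup>2 - norm x * (uh x - zh x) * (Dz x \<bullet> \<omega>)
              - norm x * Fh x * (Dp x \<bullet> \<omega>)))"

definition H_density ::
  "(plane \<Rightarrow> real) \<Rightarrow> (plane \<Rightarrow> plane) \<Rightarrow> (plane \<Rightarrow> plane) \<Rightarrow> plane \<Rightarrow> plane" where
  "H_density f Du Dp x =
     (let \<omega> = sgn x; a = f \<omega>; T = tangential_gradient f \<omega> in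
       (1 / a) *\<^sub>R ((Dp x \<bullet> \<omega>) *\<^sub>R Du x + (Du x \<bullet> \<omega>) *\<^sub>R Dp x)
       - (2 / a\<^sup>2 * (Du x \<bullet> \<omega>) * (Dp x \<bullet> \<omega>)) *\<^sub>R T)"

definition radial_mean :: "(plane \<Rightarrow> 'b::euclidean_space) \<Rightarrow> plane \<Rightarrow> 'b" where
  "radial_mean k \<omega> = (LINT s:{0..1}|lebesgue. s *\<^sub>R k (s *\<^sub>R \<omega>))"

text \<open>The functional given by \<open>\<integral> (h v + H v') d\<phi>\<close>.\<close>

definition shape_derivative :: "(real \<Rightarrow> real) \<Rightarrow> (real \<Rightarrow> real) \<Rightarrow> (real \<Rightarrow> real) \<Rightarrow> real" where
  "shape_derivative h H v = (LINT \<phi>:{0..2*pi}|lebesgue. h \<phi> * v \<phi> + H \<phi> * deriv v \<phi>)"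

end

theory Submission
  imports Defs
begin

text \<open>
  On admissible directions \<open>v\<close> (periodic, orthogonal to \<open>fb\<close>, with \<open>\<bar>v'\<bar> \<le> 1\<close>) the functional is
  the integral of \<open>v'\<close> against a continuous weight.  Integration by parts moves the derivative from \<open>v\<close> to the Lipschitz function \<open>H\<close>; the
  orthogonality allows \<open>c * fb\<close> to be subtracted, which gives \<open>\<integral> q v\<close>; since \<open>q\<close> has mean zero, its
  negative primitive \<open>G\<close> is periodic, and a second integration by parts gives \<open>\<integral> G v'\<close>.  Finally
  \<open>\<integral> v' = 0\<close>, so that the functional equals \<open>\<integral> (G - \<beta>) v'\<close>, which is at least \<open>- \<integral> \<bar>G - \<beta>\<bar>\<close>.  This lower bound
  is attained if \<open>v'\<close> is \<open>-1\<close> where \<open>G > \<beta>\<close> and \<open>1\<close> where \<open>G < \<beta>\<close>.  The level \<open>\<beta>\<close> is the one at which both of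
  these sets have measure at most \<open>pi\<close> (\<open>level_measure_bounds\<close>), so that a constant \<open>k\<close> with \<open>\<bar>k\<bar> \<le> 1\<close> on the
  remaining set \<open>G = \<beta>\<close> gives \<open>v'\<close> mean zero.  The primitive of this function is \<open>g\<close>, which is therefore
  periodic and admissible.

  The argument needs the calculus of Lipschitz functions on an interval: differentiability almost
  everywhere (\<open>negligible_nondifferentiable_lipschitz\<close>), the fundamental theorem
  (\<open>lipschitz_has_integral_deriv\<close>), integration by parts (\<open>lipschitz_integral_by_parts\<close>), and
  differentiation of indefinite integrals of essentially bounded functions
  (\<open>negligible_deriv_indefinite_integral\<close>).  Differentiability is reduced to monotone Lipschitz functions \<open>F\<close>, for
  which the set where the difference quotients oscillate across \<open>r < s\<close> is shown to be null by comparing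
  two nested Vitali covers in the Stieltjes measure of \<open>F\<close>.
\<close>

section \<open>Differentiability of Lipschitz functions almost everywhere\<close>

text \<open>
  The points at which difference quotients below \<open>r\<close> occur at arbitrarily small scales (the point
  \<open>y\<close> may lie on either side of \<open>x\<close>).  Quotients above \<open>s\<close> are covered by the same definition, applied
  to \<open>- F\<close> and \<open>- s\<close>.
\<close>

definition diffquot_below :: "(real \<Rightarrow> real) \<Rightarrow> real \<Rightarrow> real set" where
  "diffquot_below F r = {x. \<forall>d>0. \<exists>y. y \<noteq> x \<and> \<bar>y - x\<bar> < d \<and> (F y - F x) / (y - x) < r}"

lemma borel_diffquot_below:
  assumes "continuous_on UNIV F"
  shows "diffquot_below F r \<in> sets borel"
proof -
  define W where "W d = {x. \<exists>y. y \<noteq> x \<and> \<bar>y - x\<bar> < d \<and> (F y - F x) / (y - x) < r}" for d :: real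
  have "open (W d)" for d
  proof -
    have "W d = (\<Union>y. {x. y \<noteq> x \<and> (F y - F x) / (y - x) < r} \<inter> {x. \<bar>y - x\<bar> < d})"
      by (auto simp: W_def)
    moreover have "open ({x. y \<noteq> x \<and> (F y - F x) / (y - x) < r} \<inter> {x. \<bar>y - x\<bar> < d})" for y
    proof (rule open_Int)
      have "continuous_on (- {y}) (\<lambda>x. (F y - F x) / (y - x))"
        by (intro continuous_intros continuous_on_subset[OF assms]) auto
      from continuous_open_preimage[OF this, of "{..<r}"]
      show "open {x. y \<noteq> x \<and> (F y - F x) / (y - x) < r}"
        by (simp add: vimage_def Int_def eq_commute open_Compl)
      show "open {x. \<bar>y - x\<bar> < d}"
        by (intro open_Collect_less continuous_intros)
    qed
    ultimately show ?thesis by auto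
  qed
  moreover have "diffquot_below F r = (\<Inter>n. W (1 / real (Suc n)))"
  proof -
    have "x \<in> diffquot_below F r" if "\<And>n. x \<in> W (1 / real (Suc n))" for x
      unfolding diffquot_below_def
    proof (intro CollectI allI impI)
      fix d :: real assume "d > 0"
      then obtain n where n: "1 / real (Suc n) < d"
        using nat_approx_posE by blast
      then show "\<exists>y. y \<noteq> x \<and> \<bar>y - x\<bar> < d \<and> (F y - F x) / (y - x) < r"
        using that[of n] unfolding W_def by (force intro: less_trans)
    qed
    then show ?thesis
      by (auto simp: diffquot_below_def W_def)
  qed
  ultimately show ?thesis by auto
qed

text \<open>
  Vitali's covering theorem for intervals that contain the points to be covered, not necessarily as
  midpoints.  The closed intervals are disjoint, and the open ones already cover almost everything,
  because countably many endpoints form a null set; the open version is what allows a second cover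
  to be nested inside the first.
\<close>

lemma interval_Vitali:
  fixes S :: "real set"
  assumes "\<And>x d. x \<in> S \<Longrightarrow> d > 0 \<Longrightarrow> \<exists>a b. a < b \<and> x \<in> {a..b} \<and> b - a < d \<and> P a b"
  obtains C where "countable C" "\<forall>(a, b)\<in>C. a < b \<and> P a b"
    "disjoint_family_on (\<lambda>(a, b). {a..b}) C"
    "negligible (S - (\<Union>(a, b)\<in>C. {a<..<b}))"
proof -
  define K where "K = {(a, b). a < b \<and> P a b}"
  have cb: "cball ((fst i + snd i) / 2) ((snd i - fst i) / 2) = {fst i..snd i}" for i :: "real \<times> real"
    by (auto simp: cball_eq_atLeastAtMost field_simps)
  have ex: "\<exists>i. i \<in> K \<and> x \<in> cball ((fst i + snd i) / 2) ((snd i - fst i) / 2) \<and> (snd i - fst i) / 2 < d"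
    if "x \<in> S" "d > 0" for x d
    using assms[OF that] that(2) unfolding cb K_def by force
  have pos: "0 < (snd i - fst i) / 2" if "i \<in> K" for i
    using that by (auto simp: K_def)
  obtain C where C: "countable C" "C \<subseteq> K"
     "pairwise (\<lambda>i j. disjnt (cball ((fst i + snd i) / 2) ((snd i - fst i) / 2))
                              (cball ((fst j + snd j) / 2) ((snd j - fst j) / 2))) C"
     "negligible (S - (\<Union>i \<in> C. cball ((fst i + snd i) / 2) ((snd i - fst i) / 2)))"
    using Vitali_covering_theorem_cballs[of K "\<lambda>i. (snd i - fst i) / 2" S "\<lambda>i. (fst i + snd i) / 2", OF pos ex] .
  have "negligible (fst ` C \<union> snd ` C)"
    unfolding negligible_iff_null_sets
    using C(1) by (intro null_sets_completionI countable_imp_null_set_lborel) auto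
  with C(4) have "negligible ((S - (\<Union>i \<in> C. cball ((fst i + snd i) / 2) ((snd i - fst i) / 2)))
    \<union> (fst ` C \<union> snd ` C))" by (rule negligible_Un)
  then have neg: "negligible (S - (\<Union>(a, b)\<in>C. {a<..<b}))"
  proof (rule negligible_subset, intro subsetI)
    fix x assume x: "x \<in> S - (\<Union>(a, b)\<in>C. {a<..<b})"
    have "x = fst i \<or> x = snd i" if "i \<in> C" "x \<in> {fst i..snd i}" for i
      using x that by (cases i) (auto simp: less_le)
    then show "x \<in> (S - (\<Union>i \<in> C. cball ((fst i + snd i) / 2) ((snd i - fst i) / 2)))
        \<union> (fst ` C \<union> snd ` C)"
      using x unfolding cb by blast
  qed
  show thesis
  proof
    show "disjoint_family_on (\<lambda>(a, b). {a..b}) C"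
      using C(3) unfolding disjoint_family_on_def pairwise_def cb disjnt_def case_prod_unfold .
  qed (use C neg in \<open>auto simp: K_def\<close>)
qed

text \<open>
  The heart of the differentiability theorem.  Let \<open>\<mu>\<close> be the Stieltjes measure of \<open>F\<close>, so that
  \<open>\<mu> {a..b} = F b - F a\<close>.  Cover \<open>E\<close> by disjoint intervals inside \<open>U\<close> with slope below \<open>r\<close>, then cover it again
  by disjoint intervals inside the first ones, with slope above \<open>s\<close>.  Comparing the \<open>\<mu>\<close>-measures of the
  two unions gives \<open>s |E| \<le> r |U|\<close>.
\<close>

lemma nested_cover_bound:
  fixes F :: "real \<Rightarrow> real"
  assumes mono: "mono F" and cont: "continuous_on UNIV F"
    and E: "E \<in> sets borel" and U: "open U" "E \<subseteq> U" and s: "s > 0"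
    and below: "\<And>x d. x \<in> E \<Longrightarrow> d > 0 \<Longrightarrow> \<exists>y. y \<noteq> x \<and> \<bar>y - x\<bar> < d \<and> (F y - F x) / (y - x) < r"
    and above: "\<And>x d. x \<in> E \<Longrightarrow> d > 0 \<Longrightarrow> \<exists>y. y \<noteq> x \<and> \<bar>y - x\<bar> < d \<and> (F y - F x) / (y - x) > s"
  shows "ennreal s * emeasure lborel E \<le> ennreal r * emeasure lborel U"
proof -
  let ?I = "\<lambda>(a, b). {a..b :: real}"
  let ?\<mu> = "interval_measure F"
  have \<mu>: "emeasure ?\<mu> {a..b} = ennreal (F b - F a)" if "a \<le> b" for a b
    using that mono cont by (intro emeasure_interval_measure_Icc) (auto simp: mono_def)
  \<comment> \<open>The quotient is symmetric in its two points, so it is the slope over the interval that they span.\<close>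
  have ivl: "\<exists>a b. a < b \<and> x \<in> {a..b} \<and> b - a < d \<and> {a..b} \<subseteq> V \<and> Q ((F b - F a) / (b - a))"
    if Q: "\<And>d. d > 0 \<Longrightarrow> \<exists>y. y \<noteq> x \<and> \<bar>y - x\<bar> < d \<and> Q ((F y - F x) / (y - x))"
      and V: "open V" "x \<in> V" "d > 0" for x d V Q
  proof -
    obtain e where e: "e > 0" "ball x e \<subseteq> V"
      using V by (meson open_contains_ball)
    obtain y where y: "y \<noteq> x" "\<bar>y - x\<bar> < min d e" "Q ((F y - F x) / (y - x))"
      using Q[of "min d e"] V e by auto
    have "Q ((F x - F y) / (x - y))"
      using y(3) by (metis minus_diff_eq minus_divide_divide)
    moreover have "{min x y..max x y} \<subseteq> V"
    proof -
      have "{min x y..max x y} \<subseteq> ball x e"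
        using y(2) by (auto simp: dist_real_def)
      with e show ?thesis by auto
    qed
    ultimately show ?thesis
      using y by (intro exI[of _ "min x y"] exI[of _ "max x y"])
        (cases "x < y"; auto simp: min_def max_def split: if_splits)
  qed
  have ex1: "\<exists>a b. a < b \<and> x \<in> {a..b} \<and> b - a < d \<and> {a..b} \<subseteq> U \<and> (F b - F a) / (b - a) < r"
    if "x \<in> E" "d > 0" for x d
    using that
    by (intro ivl[where Q="\<lambda>t. t < r"] below) (use U in auto)
  obtain C1 where C1: "countable C1"
      "\<forall>(a, b)\<in>C1. a < b \<and> {a..b} \<subseteq> U \<and> (F b - F a) / (b - a) < r"
      "disjoint_family_on ?I C1" "negligible (E - (\<Union>(a, b)\<in>C1. {a<..<b}))"
    using interval_Vitali[of "E" "\<lambda>a b. {a..b} \<subseteq> U \<and> (F b - F a) / (b - a) < r", OF ex1] .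
  define U1 where "U1 = (\<Union>(a, b)\<in>C1. {a<..<b})"
  have "open U1" by (auto simp: U1_def)
  have ex2: "\<exists>a b. a < b \<and> x \<in> {a..b} \<and> b - a < d \<and> {a..b} \<subseteq> U1 \<and> (F b - F a) / (b - a) > s"
    if "x \<in> E \<inter> U1" "d > 0" for x d
    using that
    by (intro ivl[where Q="\<lambda>t. t > s"] above) (use \<open>open U1\<close> in auto)
  obtain C2 where C2: "countable C2"
      "\<forall>(a, b)\<in>C2. a < b \<and> {a..b} \<subseteq> U1 \<and> (F b - F a) / (b - a) > s"
      "disjoint_family_on ?I C2" "negligible (E \<inter> U1 - (\<Union>(a, b)\<in>C2. {a<..<b}))"
    using interval_Vitali[of "E \<inter> U1" "\<lambda>a b. {a..b} \<subseteq> U1 \<and> (F b - F a) / (b - a) > s", OF ex2] .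
  have sets1: "(\<Union>i\<in>C1. ?I i) \<in> sets borel" and sets2: "(\<Union>i\<in>C2. ?I i) \<in> sets borel"
    using C1(1) C2(1) by (auto intro!: sets.countable_UN')
  have "(\<Union>(a, b)\<in>C2. {a<..<b}) \<subseteq> (\<Union>i\<in>C2. ?I i)"
    by (intro UN_mono) auto
  then have "E - (\<Union>i\<in>C2. ?I i) \<subseteq> (E - U1) \<union> (E \<inter> U1 - (\<Union>(a, b)\<in>C2. {a<..<b}))"
    by blast
  then have "negligible (E - (\<Union>i\<in>C2. ?I i))"
    using negligible_Un[OF C1(4)[folded U1_def] C2(4)] by (rule negligible_subset[rotated])
  then have "E - (\<Union>i\<in>C2. ?I i) \<in> null_sets lborel"
    using E sets2 by (simp add: negligible_iff_null_sets null_sets_completion_iff)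
  then have "emeasure lborel E \<le> emeasure lborel (\<Union>i\<in>C2. ?I i)"
    using E sets2 by (intro emeasure_mono_AE) (auto dest: AE_not_in)
  then have "ennreal s * emeasure lborel E \<le> ennreal s * emeasure lborel (\<Union>i\<in>C2. ?I i)"
    by (rule mult_left_mono) simp
  also have "\<dots> = ennreal s * (\<integral>\<^sup>+i. emeasure lborel (?I i) \<partial>count_space C2)"
    using C2 by (subst emeasure_UN_countable) auto
  also have "\<dots> = (\<integral>\<^sup>+i. ennreal s * emeasure lborel (?I i) \<partial>count_space C2)"
    by (simp add: nn_integral_cmult)
  also have "\<dots> \<le> (\<integral>\<^sup>+i. emeasure ?\<mu> (?I i) \<partial>count_space C2)"
  proof (rule nn_integral_mono, clarsimp)
    fix a b assume "(a, b) \<in> C2"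
    from C2(2) this s have "a < b" "s * (b - a) \<le> F b - F a"
      by (auto simp: field_simps)
    with s show "ennreal s * emeasure lborel {a..b} \<le> emeasure ?\<mu> {a..b}"
      by (simp add: \<mu> ennreal_mult[symmetric] ennreal_leI)
  qed
  also have "\<dots> = emeasure ?\<mu> (\<Union>i\<in>C2. ?I i)"
    using C2 by (subst emeasure_UN_countable) auto
  also have "\<dots> \<le> emeasure ?\<mu> (\<Union>i\<in>C1. ?I i)"
  proof (rule emeasure_mono)
    have "(\<Union>i\<in>C2. ?I i) \<subseteq> U1"
      using C2(2) by blast
    also have "\<dots> \<subseteq> (\<Union>i\<in>C1. ?I i)"
      unfolding U1_def by (intro UN_mono) auto
    finally show "(\<Union>i\<in>C2. ?I i) \<subseteq> (\<Union>i\<in>C1. ?I i)" .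
  qed (simp add: sets1)
  also have "\<dots> = (\<integral>\<^sup>+i. emeasure ?\<mu> (?I i) \<partial>count_space C1)"
    using C1 by (subst emeasure_UN_countable) auto
  also have "\<dots> \<le> (\<integral>\<^sup>+i. ennreal r * emeasure lborel (?I i) \<partial>count_space C1)"
  proof (rule nn_integral_mono, clarsimp)
    fix a b assume "(a, b) \<in> C1"
    from C1(2) this have ab: "a < b" "(F b - F a) / (b - a) < r" by auto
    moreover have "F a \<le> F b" using mono ab by (auto simp: mono_def)
    ultimately have "F b - F a \<le> r * (b - a)" "0 \<le> r"
      by (auto simp: field_simps intro: less_imp_le order_trans[OF _ less_imp_le[OF ab(2)]])
    with ab show "emeasure ?\<mu> {a..b} \<le> ennreal r * emeasure lborel {a..b}"
      by (simp add: \<mu> ennreal_mult[symmetric] ennreal_leI)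
  qed
  also have "\<dots> = ennreal r * emeasure lborel (\<Union>i\<in>C1. ?I i)"
    using C1 by (subst emeasure_UN_countable) (auto simp: nn_integral_cmult)
  also have "\<dots> \<le> ennreal r * emeasure lborel U"
  proof (intro mult_left_mono emeasure_mono)
    show "(\<Union>i\<in>C1. ?I i) \<subseteq> U" using C1(2) by blast
  qed (use U in auto)
  finally show ?thesis .
qed

text \<open>
  Letting the open set in the previous bound shrink to the exceptional set \<open>E\<close>, one gets
  \<open>s |E| \<le> max r 0 * |E|\<close> with \<open>r < s\<close> and \<open>s > 0\<close>, hence \<open>|E| = 0\<close>.  The intersection with balls makes \<open>|E|\<close> finite.
\<close>

lemma null_oscillating_quotients:
  fixes F :: "real \<Rightarrow> real"
  assumes mono: "mono F" and cont: "continuous_on UNIV F" and rs: "r < s" "0 < s"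
  shows "negligible (diffquot_below F r \<inter> diffquot_below (\<lambda>x. - F x) (- s))"
proof -
  define E where "E = diffquot_below F r \<inter> diffquot_below (\<lambda>x. - F x) (- s)"
  have E: "E \<in> sets borel"
    unfolding E_def using cont by (intro sets.Int borel_diffquot_below continuous_intros)
  have "negligible (E \<inter> ball 0 m)" for m
  proof -
    let ?E = "E \<inter> ball 0 m"
    have Em: "?E \<in> sets borel" using E by auto
    have fin: "emeasure lborel ?E < \<infinity>"
      by (rule le_less_trans[OF emeasure_mono[of _ "ball 0 m"]]) (use emeasure_lborel_ball_finite[of 0 m] in auto)
    then obtain t where t: "emeasure lborel ?E = ennreal t" "t \<ge> 0"
      by (metis ennreal_cases infinity_ennreal_def less_irrefl)
    have le: "s * t \<le> max r 0 * (t + e)" if e: "e > 0" for e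
    proof -
      obtain U where U: "open U" "?E \<subseteq> U" "emeasure lborel (U - ?E) < ennreal e"
        using outer_regular_lborel[OF Em e] by blast
      have "emeasure lborel U = emeasure lborel ?E + emeasure lborel (U - ?E)"
        using U Em by (subst plus_emeasure) (auto intro: arg_cong[where f="emeasure lborel"])
      also have "\<dots> \<le> ennreal t + ennreal e"
        using U(3) t by (intro add_mono) auto
      finally have Ule: "emeasure lborel U \<le> ennreal (t + e)" using t e by simp
      have "ennreal s * emeasure lborel ?E \<le> ennreal r * emeasure lborel U"
      proof (rule nested_cover_bound[OF mono cont Em U(1,2) rs(2)])
        fix x d :: real assume x: "x \<in> ?E" and d: "d > 0"
        show "\<exists>y. y \<noteq> x \<and> \<bar>y - x\<bar> < d \<and> (F y - F x) / (y - x) < r"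
          using x d by (auto simp: E_def diffquot_below_def)
        obtain y where "y \<noteq> x" "\<bar>y - x\<bar> < d" "(- F y - - F x) / (y - x) < - s"
          using x d by (auto simp: E_def diffquot_below_def)
        moreover have "(- F y - - F x) / (y - x) = - ((F y - F x) / (y - x))"
          by (simp add: minus_divide_left)
        ultimately show "\<exists>y. y \<noteq> x \<and> \<bar>y - x\<bar> < d \<and> s < (F y - F x) / (y - x)"
          by (intro exI[of _ y]) auto
      qed
      also have "\<dots> \<le> ennreal (max r 0) * ennreal (t + e)"
        by (rule mult_mono[OF _ Ule]) (auto simp: ennreal_leI)
      finally show ?thesis
        using t rs e by (simp add: ennreal_mult[symmetric] del: ennreal_plus)
    qed
    have "s * t \<le> max r 0 * t"
    proof (rule field_le_epsilon)
      fix e :: real assume e: "e > 0"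
      have "s * t \<le> max r 0 * (t + e / (max r 0 + 1))"
        by (rule le) (use e in \<open>auto simp: add_nonneg_pos\<close>)
      also have "\<dots> \<le> max r 0 * t + e"
        using e by (auto simp: field_simps max_def)
      finally show "s * t \<le> max r 0 * t + e" .
    qed
    then have "t = 0" using rs t by (auto simp: max_def mult_le_cancel_right split: if_splits)
    with t have "?E \<in> null_sets lborel" using Em by auto
    then show ?thesis
      by (simp add: negligible_iff_null_sets null_sets_completionI)
  qed
  then have "negligible (\<Union>m::nat. E \<inter> ball 0 (real m))"
    by (intro negligible_countable_Union) auto
  then show ?thesis
    unfolding E_def[symmetric]
    by (rule negligible_subset) (use reals_Archimedean2 in fastforce)
qed

lemma bounded_tendsto_if_not_oscillating:
  fixes q :: "'a \<Rightarrow> real"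
  assumes "F \<noteq> bot" and bound: "eventually (\<lambda>x. \<bar>q x\<bar> \<le> K) F"
    and osc: "\<And>r s. r < s \<Longrightarrow> frequently (\<lambda>x. q x < r) F \<Longrightarrow> frequently (\<lambda>x. q x > s) F \<Longrightarrow> False"
  shows "\<exists>l. (q \<longlongrightarrow> l) F"
proof -
  let ?e = "\<lambda>x. ereal (q x)"
  have lo: "Liminf F ?e \<ge> ereal (- K)"
    by (rule Liminf_bounded) (use bound in \<open>auto elim: eventually_mono\<close>)
  have hi: "Limsup F ?e \<le> ereal K"
    by (rule Limsup_bounded) (use bound in \<open>auto elim: eventually_mono\<close>)
  have le: "Liminf F ?e \<le> Limsup F ?e"
    by (rule Liminf_le_Limsup) fact
  have "\<not> Liminf F ?e < Limsup F ?e"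
  proof
    assume "Liminf F ?e < Limsup F ?e"
    then obtain r where r: "Liminf F ?e < ereal r" "ereal r < Limsup F ?e"
      using ereal_dense2 by blast
    then obtain s where s: "ereal r < ereal s" "ereal s < Limsup F ?e"
      using ereal_dense2 by blast
    have "frequently (\<lambda>x. q x < (r + s) / 2) F"
    proof (rule ccontr)
      assume "\<not> ?thesis"
      then have "eventually (\<lambda>x. ereal r \<le> ?e x) F"
        unfolding frequently_def by (rule eventually_mono[OF notnotD]) (use s(1) in \<open>auto simp: field_simps\<close>)
      then have "ereal r \<le> Liminf F ?e" by (rule Liminf_bounded)
      with r show False by simp
    qed
    moreover have "frequently (\<lambda>x. q x > (r + 2 * s) / 3) F"
    proof (rule ccontr)
      assume "\<not> ?thesis"
      then have "eventually (\<lambda>x. ?e x \<le> ereal s) F"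
        unfolding frequently_def by (rule eventually_mono[OF notnotD]) (use s(1) in \<open>auto simp: field_simps\<close>)
      then have "Limsup F ?e \<le> ereal s" by (rule Limsup_bounded)
      with s show False by simp
    qed
    ultimately show False
      using s(1) by (intro osc[of "(r + s) / 2" "(r + 2 * s) / 3"]) auto
  qed
  with le have eq: "Liminf F ?e = Limsup F ?e" by simp
  obtain l where l: "Limsup F ?e = ereal l"
    using lo hi le by (cases "Limsup F ?e") auto
  have "(?e \<longlongrightarrow> ereal l) F"
    using assms(1) eq l by (intro Liminf_eq_Limsup) auto
  then show ?thesis by auto
qed

lemma negligible_nondifferentiable_mono_lipschitz:
  fixes F :: "real \<Rightarrow> real"
  assumes mono: "mono F" and lip: "L-lipschitz_on UNIV F"
  shows "negligible {x. \<not> F differentiable (at x)}"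
proof -
  define I where "I = {(r, s). r \<in> \<rat> \<and> s \<in> \<rat> \<and> r < s \<and> 0 < (s::real)}"
  define E where "E = (\<lambda>(r, s). diffquot_below F r \<inter> diffquot_below (\<lambda>x. - F x) (- s))"
  have cont: "continuous_on UNIV F" by (rule lipschitz_on_continuous_on[OF lip])
  have "countable I"
    by (rule countable_subset[of _ "\<rat> \<times> \<rat>"]) (auto simp: I_def countable_rat)
  then have "negligible (\<Union>i\<in>I. E i)"
    by (intro negligible_countable_Union) (auto simp: I_def E_def null_oscillating_quotients[OF mono cont])
  moreover have "x \<in> (\<Union>i\<in>I. E i)" if x: "\<not> F differentiable (at x)" for x
  proof (rule ccontr)
    assume nE: "x \<notin> (\<Union>i\<in>I. E i)"
    define q where "q y = (F y - F x) / (y - x)" for y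
    have q0: "0 \<le> q y" for y
      using mono by (cases "x < y") (auto simp: q_def mono_def divide_nonpos_nonpos)
    have "\<exists>l. (q \<longlongrightarrow> l) (at x)"
    proof (rule bounded_tendsto_if_not_oscillating[where K = L])
      have "\<bar>q y\<bar> \<le> L" if "y \<noteq> x" for y
        using lipschitz_onD[OF lip, of y x] that
        by (auto simp: q_def dist_real_def abs_divide field_simps)
      then show "\<forall>\<^sub>F y in at x. \<bar>q y\<bar> \<le> L"
        by (auto simp: eventually_at_filter)
    next
      fix r s :: real
      assume rs: "r < s" and r: "\<exists>\<^sub>F y in at x. q y < r" and s: "\<exists>\<^sub>F y in at x. q y > s"
      obtain s' where s': "s' \<in> \<rat>" "r < s'" "s' < s" using Rats_dense_in_real[OF rs] by auto
      obtain r' where r': "r' \<in> \<rat>" "r < r'" "r' < s'" using Rats_dense_in_real[OF s'(2)] by auto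
      have r1: "\<exists>\<^sub>F y in at x. q y < r'"
        using r by (rule frequently_elim1) (use r' in auto)
      have s1: "\<exists>\<^sub>F y in at x. q y > s'"
        using s by (rule frequently_elim1) (use s' in auto)
      have "r' > 0"
        using frequently_ex[OF r1] q0 by (auto intro: le_less_trans)
      then have "(r', s') \<in> I" using r' s' by (auto simp: I_def)
      moreover have "x \<in> diffquot_below F r'"
        using r1 by (auto simp: frequently_at diffquot_below_def q_def dist_real_def)
      moreover have "x \<in> diffquot_below (\<lambda>x. - F x) (- s')"
      proof -
        have "(- F y - - F x) / (y - x) < - s' \<longleftrightarrow> q y > s'" for y
        proof -
          have "(- F y - - F x) / (y - x) = - q y"
            unfolding q_def by (metis minus_diff_minus minus_divide_left)
          then show ?thesis by simp
        qed
        then show ?thesis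
          using s1 by (auto simp: frequently_at diffquot_below_def dist_real_def)
      qed
      ultimately show False using nE by (auto simp: E_def)
    qed simp
    then obtain l where "(F has_field_derivative l) (at x)"
      unfolding q_def by (auto simp: has_field_derivative_iff)
    with x show False by (metis real_differentiable_def)
  qed
  ultimately show ?thesis
    by (auto elim: negligible_subset)
qed

lemma lipschitz_clamp:
  fixes f :: "real \<Rightarrow> real"
  assumes lip: "L-lipschitz_on {a..b} f" and ab: "a \<le> b"
  shows "\<bar>f (max a (min b x)) - f (max a (min b y))\<bar> \<le> L * \<bar>x - y\<bar>"
proof -
  have "\<bar>f (max a (min b x)) - f (max a (min b y))\<bar> \<le> L * \<bar>max a (min b x) - max a (min b y)\<bar>"
    using lipschitz_onD[OF lip, of "max a (min b x)" "max a (min b y)"] ab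
    by (auto simp: dist_real_def)
  also have "\<dots> \<le> L * \<bar>x - y\<bar>"
    using lipschitz_on_nonneg[OF lip] by (intro mult_left_mono) (auto simp: max_def min_def)
  finally show ?thesis .
qed

text \<open>
  The restriction to an interval and the monotonicity are removed by extending \<open>f\<close> constantly beyond
  the endpoints and by adding \<open>L * x\<close>.
\<close>

lemma negligible_nondifferentiable_lipschitz:
  fixes f :: "real \<Rightarrow> real"
  assumes lip: "L-lipschitz_on {a..b} f"
  shows "negligible {x \<in> {a<..<b}. \<not> f differentiable (at x)}"
proof (cases "a < b")
  case True
  define c where "c x = max a (min b x)" for x
  define g where "g x = f (c x)" for x
  have L0: "L \<ge> 0" by (rule lipschitz_on_nonneg[OF lip])
  have g: "\<bar>g x - g y\<bar> \<le> L * \<bar>x - y\<bar>" for x y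
    unfolding g_def c_def using lipschitz_clamp[OF lip] True by simp
  define F where "F x = g x + L * x" for x
  have mono: "mono F"
  proof (rule monoI)
    fix x y :: real assume "x \<le> y"
    then have "g x - g y \<le> L * (y - x)"
      using g[of x y] by auto
    then show "F x \<le> F y" by (simp add: F_def algebra_simps)
  qed
  have lipF: "(L + L)-lipschitz_on UNIV F"
    unfolding F_def
  proof (rule lipschitz_on_add)
    show "L-lipschitz_on UNIV g" using g L0 by (auto intro!: lipschitz_onI simp: dist_real_def)
    show "L-lipschitz_on UNIV ((*) L)"
      using L0 by (auto intro!: lipschitz_onI simp: dist_real_def abs_mult right_diff_distrib[symmetric])
  qed
  have "f differentiable (at x)" if x: "x \<in> {a<..<b}" and d: "F differentiable (at x)" for x
  proof -
    have "(\<lambda>y. F y - L * y) differentiable (at x)"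
      using d by (intro differentiable_diff) auto
    then obtain D where "(g has_derivative D) (at x)"
      by (auto simp: F_def differentiable_def)
    then have "(f has_derivative D) (at x)"
      by (rule has_derivative_transform_within_open[of _ _ _ _ "{a<..<b}"])
         (use x in \<open>auto simp: g_def c_def\<close>)
    then show ?thesis by (auto simp: differentiable_def)
  qed
  then have "{x \<in> {a<..<b}. \<not> f differentiable (at x)} \<subseteq> {x. \<not> F differentiable (at x)}"
    by auto
  with negligible_nondifferentiable_mono_lipschitz[OF mono lipF] show ?thesis
    by (rule negligible_subset)
qed auto

section \<open>Calculus for Lipschitz functions and indefinite integrals\<close>

lemma lipschitz_abs_deriv_le:
  fixes f :: "real \<Rightarrow> real"
  assumes lip: "L-lipschitz_on {a..b} f" and x: "x \<in> {a<..<b}" and d: "f differentiable (at x)"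
  shows "\<bar>deriv f x\<bar> \<le> L"
proof -
  have "(f has_field_derivative deriv f x) (at x)"
    using d by (simp add: DERIV_deriv_iff_real_differentiable)
  then have lim: "((\<lambda>y. \<bar>(f y - f x) / (y - x)\<bar>) \<longlongrightarrow> \<bar>deriv f x\<bar>) (at x)"
    by (intro tendsto_rabs) (simp add: has_field_derivative_iff)
  have "\<bar>(f y - f x) / (y - x)\<bar> \<le> L" if "y \<noteq> x" "y \<in> {a<..<b}" for y
    using lipschitz_onD[OF lip, of y x] that x
    by (auto simp: dist_real_def abs_divide field_simps)
  then have "\<forall>\<^sub>F y in at x. \<bar>(f y - f x) / (y - x)\<bar> \<le> L"
    using x unfolding eventually_at_topological by (intro exI[of _ "{a<..<b}"]) auto
  then show ?thesis
    by (intro tendsto_upperbound[OF lim]) auto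
qed

text \<open>
  The fundamental theorem of calculus for Lipschitz functions: the difference quotients with step
  \<open>1 / (n + 1)\<close> of the extended function are bounded by \<open>L\<close> and converge to the derivative almost
  everywhere, so their integrals converge by dominated convergence.  Those integrals are computed from
  a primitive \<open>\<Gamma>\<close> of the extended function.
\<close>

lemma lipschitz_has_integral_deriv:
  fixes f :: "real \<Rightarrow> real"
  assumes lip: "L-lipschitz_on {a..b} f" and ab: "a \<le> b"
  shows "(deriv f has_integral (f b - f a)) {a..b}"
    and "deriv f absolutely_integrable_on {a..b}"
proof -
  define c where "c x = max a (min b x)" for x
  define g where "g x = f (c x)" for x
  define S where "S = {x \<in> {a<..<b}. f differentiable (at x)}"
  have L0: "L \<ge> 0" by (rule lipschitz_on_nonneg[OF lip])
  have g: "\<bar>g x - g y\<bar> \<le> L * \<bar>x - y\<bar>" for x y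
    unfolding g_def c_def by (rule lipschitz_clamp[OF lip ab])
  have S: "negligible (S - {a..b})" "negligible ({a..b} - S)"
  proof -
    have "{a..b} - S \<subseteq> {x \<in> {a<..<b}. \<not> f differentiable (at x)} \<union> {a, b}"
      by (auto simp: S_def)
    then show "negligible ({a..b} - S)"
      by (rule negligible_subset[rotated])
         (use negligible_nondifferentiable_lipschitz[OF lip] in auto)
    show "negligible (S - {a..b})" by (simp add: S_def Diff_eq_empty_iff[THEN iffD2] subset_iff)
  qed
  have contg: "continuous_on A g" for A
    by (rule lipschitz_on_continuous_on[of L])
       (use g L0 in \<open>auto intro!: lipschitz_onI simp: dist_real_def\<close>)
  \<comment> \<open>The interval is enlarged so that the endpoints and their translates are interior points.\<close>
  obtain \<Gamma> where \<Gamma>': "\<And>x. x \<in> {a-1..b+2} \<Longrightarrow> (\<Gamma> has_vector_derivative g x) (at x within {a-1..b+2})"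
    using antiderivative_continuous[OF contg[of "{a-1..b+2}"]] by metis
  have \<Gamma>: "(\<Gamma> has_real_derivative g x) (at x)" if "x \<in> {a-1<..<b+2}" for x
  proof -
    have x: "x \<in> {a-1..b+2}" using that by auto
    have at: "at x within {a-1..b+2} = at x"
      by (rule at_within_interior) (use that in auto)
    show ?thesis
      using \<Gamma>'[OF x] unfolding at has_real_derivative_iff_has_vector_derivative .
  qed
  define Q where "Q n x = (g (x + 1 / Suc n) - g x) / (1 / Suc n)" for n :: nat and x
  have Q: "(Q n has_integral ((\<Gamma> (b + 1 / Suc n) - \<Gamma> b) / (1 / Suc n) - (\<Gamma> (a + 1 / Suc n) - \<Gamma> a) / (1 / Suc n))) {a..b}" for n
  proof -
    let ?h = "1 / real (Suc n)"
    have h: "0 < ?h" "?h \<le> 1" by auto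
    have "((\<lambda>x. (\<Gamma> (x + ?h) - \<Gamma> x) / ?h) has_real_derivative Q n x) (at x within {a..b})"
      if "x \<in> {a..b}" for x
    proof -
      have 1: "((\<lambda>x. \<Gamma> (x + ?h)) has_real_derivative g (x + ?h)) (at x)"
      proof -
        have "a - 1 < x + ?h" "x + ?h < b + 2"
          using h that unfolding atLeastAtMost_iff by linarith+
        then have "x + ?h \<in> {a-1<..<b+2}"
          unfolding greaterThanLessThan_iff by blast
        from \<Gamma>[OF this] show ?thesis by (simp only: DERIV_shift)
      qed
      have 2: "(\<Gamma> has_real_derivative g x) (at x)"
        using \<Gamma>[of x] that by simp
      show ?thesis
        unfolding Q_def using DERIV_cdivide[OF DERIV_diff[OF 1 2], of ?h] by (rule DERIV_subset) simp
    qed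
    then show ?thesis
      using ab by (intro fundamental_theorem_of_calculus)
        (auto simp: has_real_derivative_iff_has_vector_derivative[symmetric])
  qed
  have lim: "(\<lambda>n. (\<Gamma> (x + 1 / Suc n) - \<Gamma> x) / (1 / Suc n)) \<longlonglongrightarrow> f x" if "x = a \<or> x = b" for x
  proof -
    have "((\<lambda>h. (\<Gamma> (x + h) - \<Gamma> x) / h) \<longlongrightarrow> g x) (at 0)"
      using \<Gamma>[of x] that ab by (auto simp: DERIV_def)
    moreover have "filterlim (\<lambda>n. 1 / real (Suc n)) (at 0) sequentially"
      using LIMSEQ_inverse_real_of_nat by (auto simp: filterlim_at inverse_eq_divide)
    ultimately have "(\<lambda>n. (\<Gamma> (x + 1 / Suc n) - \<Gamma> x) / (1 / Suc n)) \<longlonglongrightarrow> g x"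
      by (rule filterlim_compose)
    then show ?thesis using that ab by (auto simp: g_def c_def)
  qed
  have QS: "Q n integrable_on S" "integral S (Q n) = integral {a..b} (Q n)" for n
  proof -
    have "Q n integrable_on {a..b}" using Q by blast
    then show "Q n integrable_on S"
      by (rule integrable_spike_set) (use S in \<open>auto elim: negligible_subset\<close>)
    show "integral S (Q n) = integral {a..b} (Q n)"
      by (rule integral_spike_set) (use S in \<open>auto elim: negligible_subset\<close>)
  qed
  have bound: "norm (Q n x) \<le> L" for n x
  proof -
    have h: "0 < 1 / real (Suc n)" by simp
    have "\<bar>g (x + 1 / Suc n) - g x\<bar> \<le> L * (1 / Suc n)"
      using g[of "x + 1 / Suc n" x] by simp
    then show ?thesis
      unfolding Q_def real_norm_def abs_div_pos[OF h, symmetric] pos_divide_le_eq[OF h] .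
  qed
  have const: "(\<lambda>x. L) integrable_on S"
    by (rule integrable_spike_set[of _ "{a..b}"]) (use S in \<open>auto elim: negligible_subset\<close>)
  have conv: "(\<lambda>n. Q n x) \<longlonglongrightarrow> deriv f x" if "x \<in> S" for x
  proof -
    have x: "x \<in> {a<..<b}" and fx: "(f has_field_derivative deriv f x) (at x)"
      using that by (auto simp: S_def DERIV_deriv_iff_real_differentiable)
    have "(g has_field_derivative deriv f x) (at x)"
      by (rule has_field_derivative_transform_within_open[OF fx open_greaterThanLessThan x])
         (auto simp: g_def c_def)
    then have "((\<lambda>h. (g (x + h) - g x) / h) \<longlongrightarrow> deriv f x) (at 0)"
      by (simp add: DERIV_def)
    moreover have "filterlim (\<lambda>n. 1 / real (Suc n)) (at 0) sequentially"
      using LIMSEQ_inverse_real_of_nat by (auto simp: filterlim_at inverse_eq_divide)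
    ultimately show ?thesis
      unfolding Q_def by (rule filterlim_compose)
  qed
  have int: "deriv f integrable_on S" and "(\<lambda>n. integral S (Q n)) \<longlonglongrightarrow> integral S (deriv f)"
    using dominated_convergence[OF QS(1) const bound conv] by auto
  then have "(\<lambda>n. integral {a..b} (Q n)) \<longlonglongrightarrow> integral S (deriv f)"
    by (simp add: QS)
  moreover have "(\<lambda>n. integral {a..b} (Q n)) \<longlonglongrightarrow> f b - f a"
    using tendsto_diff[OF lim[of b] lim[of a]] by (simp add: integral_unique[OF Q])
  ultimately have "integral S (deriv f) = f b - f a"
    by (rule LIMSEQ_unique)
  then have "(deriv f has_integral (f b - f a)) S" using int by (simp add: has_integral_iff)
  then show "(deriv f has_integral (f b - f a)) {a..b}"
    by (subst has_integral_spike_set_eq[of _ S]) (use S in \<open>auto elim: negligible_subset\<close>)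
  have "deriv f absolutely_integrable_on S"
    using int const lipschitz_abs_deriv_le[OF lip]
    by (intro absolutely_integrable_integrable_bound[of S _ "\<lambda>x. L"]) (auto simp: S_def)
  then show "deriv f absolutely_integrable_on {a..b}"
    by (subst absolutely_integrable_spike_set_eq[of _ S]) (use S in \<open>auto elim: negligible_subset\<close>)
qed

lemma integral_le_negligible:
  fixes u w :: "real \<Rightarrow> real"
  assumes "u integrable_on S" "w integrable_on S" and N: "negligible N"
    and le: "\<And>x. x \<in> S - N \<Longrightarrow> u x \<le> w x"
  shows "integral S u \<le> integral S w"
proof -
  define w' where "w' x = (if x \<in> N then u x else w x)" for x
  have "w' integrable_on S"
    by (rule integrable_spike[OF assms(2) N]) (simp add: w'_def)
  then have "integral S u \<le> integral S w'"
    using le by (intro integral_le assms) (auto simp: w'_def)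
  also have "integral S w' = integral S w"
    by (rule integral_spike[OF N]) (simp add: w'_def)
  finally show ?thesis .
qed

lemma lipschitz_on_mult_bounded:
  fixes u w :: "'a::metric_space \<Rightarrow> real"
  assumes u: "L-lipschitz_on S u" "\<And>x. x \<in> S \<Longrightarrow> \<bar>u x\<bar> \<le> A"
    and w: "M-lipschitz_on S w" "\<And>x. x \<in> S \<Longrightarrow> \<bar>w x\<bar> \<le> B"
    and AB: "0 \<le> A" "0 \<le> B"
  shows "(L * B + A * M)-lipschitz_on S (\<lambda>x. u x * w x)"
proof (rule lipschitz_onI)
  have L: "0 \<le> L" "0 \<le> M" using u w lipschitz_on_nonneg by blast+
  then show "0 \<le> L * B + A * M" using AB by simp
  fix x y assume xy: "x \<in> S" "y \<in> S"
  have "\<bar>u x * w x - u y * w y\<bar> = \<bar>(u x - u y) * w x + u y * (w x - w y)\<bar>"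
    by (simp add: algebra_simps)
  also have "\<dots> \<le> \<bar>u x - u y\<bar> * \<bar>w x\<bar> + \<bar>u y\<bar> * \<bar>w x - w y\<bar>"
    by (metis abs_mult abs_triangle_ineq)
  also have "\<dots> \<le> (L * dist x y) * B + A * (M * dist x y)"
    using lipschitz_onD[OF u(1) xy] lipschitz_onD[OF w(1) xy] u(2) w(2) xy L AB
    by (intro add_mono mult_mono) (auto simp: dist_real_def)
  finally show "dist (u x * w x) (u y * w y) \<le> (L * B + A * M) * dist x y"
    by (simp add: dist_real_def algebra_simps)
qed

lemma lipschitz_on_Icc_bounded:
  fixes u :: "real \<Rightarrow> real"
  assumes "L-lipschitz_on {a..b} u"
  shows "\<exists>A\<ge>0. \<forall>x\<in>{a..b}. \<bar>u x\<bar> \<le> A"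
proof -
  have "bounded (u ` {a..b})"
    using lipschitz_on_continuous_on[OF assms]
    by (intro compact_imp_bounded compact_continuous_image) auto
  then obtain A where "A > 0" "\<And>x. x \<in> {a..b} \<Longrightarrow> \<bar>u x\<bar> \<le> A"
    by (auto simp: bounded_pos)
  then show ?thesis by (intro exI[of _ A]) auto
qed

lemma continuous_mult_absolutely_integrable:
  fixes u w :: "real \<Rightarrow> real"
  assumes "continuous_on {a..b} u" "w absolutely_integrable_on {a..b}"
  shows "(\<lambda>x. u x * w x) absolutely_integrable_on {a..b}"
  using assms
  by (intro absolutely_integrable_bounded_measurable_product_real)
     (auto intro: continuous_imp_measurable_on_sets_lebesgue compact_imp_bounded compact_continuous_image)

lemma lipschitz_integral_by_parts:
  fixes u w :: "real \<Rightarrow> real"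
  assumes u: "L-lipschitz_on {a..b} u" and w: "M-lipschitz_on {a..b} w" and ab: "a \<le> b"
  shows "integral {a..b} (\<lambda>x. u x * deriv w x)
    = u b * w b - u a * w a - integral {a..b} (\<lambda>x. deriv u x * w x)"
proof -
  obtain A where A: "0 \<le> A" "\<And>x. x \<in> {a..b} \<Longrightarrow> \<bar>u x\<bar> \<le> A" 
    using lipschitz_on_Icc_bounded[OF u] by blast
  obtain B where B: "0 \<le> B" "\<And>x. x \<in> {a..b} \<Longrightarrow> \<bar>w x\<bar> \<le> B" 
    using lipschitz_on_Icc_bounded[OF w] by blast
  note uw = lipschitz_on_mult_bounded[OF u A(2) w B(2) A(1) B(1)]
  define N where "N = {a, b} \<union> {x \<in> {a<..<b}. \<not> u differentiable (at x)} \<union> {x \<in> {a<..<b}. \<not> w differentiable (at x)}"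
  have N: "negligible N"
    unfolding N_def by (intro negligible_Un negligible_nondifferentiable_lipschitz[OF u]
        negligible_nondifferentiable_lipschitz[OF w]) auto
  have D: "deriv (\<lambda>x. u x * w x) x = u x * deriv w x + deriv u x * w x" if "x \<in> {a..b} - N" for x
  proof -
    have "(u has_field_derivative deriv u x) (at x)" "(w has_field_derivative deriv w x) (at x)"
      using that by (auto simp: N_def DERIV_deriv_iff_real_differentiable)
    then have "((\<lambda>x. u x * w x) has_field_derivative u x * deriv w x + deriv u x * w x) (at x)"
      by (auto intro!: derivative_eq_intros)
    then show ?thesis by (rule DERIV_imp_deriv)
  qed
  have i1: "(\<lambda>x. u x * deriv w x) integrable_on {a..b}"
    using continuous_mult_absolutely_integrable[OF lipschitz_on_continuous_on[OF u] lipschitz_has_integral_deriv(2)[OF w ab]]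
    by (rule set_lebesgue_integral_eq_integral(1))
  have i2: "(\<lambda>x. deriv u x * w x) integrable_on {a..b}"
    using continuous_mult_absolutely_integrable[OF lipschitz_on_continuous_on[OF w] lipschitz_has_integral_deriv(2)[OF u ab]]
    by (subst mult.commute) (rule set_lebesgue_integral_eq_integral(1))
  have "u b * w b - u a * w a = integral {a..b} (deriv (\<lambda>x. u x * w x))"
    using lipschitz_has_integral_deriv(1)[OF uw ab] by (simp add: integral_unique)
  also have "\<dots> = integral {a..b} (\<lambda>x. u x * deriv w x + deriv u x * w x)"
    by (rule integral_spike[OF N]) (use D in auto)
  also have "\<dots> = integral {a..b} (\<lambda>x. u x * deriv w x) + integral {a..b} (\<lambda>x. deriv u x * w x)"
    by (rule integral_add[OF i1 i2])
  finally show ?thesis by simp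
qed

text \<open>
  The integral of \<open>w\<close> vanishes on all intervals, hence on all Borel sets by Dynkin's argument.  A Borel
  representative \<open>D'\<close> of \<open>w\<close> is used since the induction runs over Borel sets.
\<close>

lemma negligible_nonzero_if_integrals_zero:
  fixes w :: "real \<Rightarrow> real"
  assumes w: "w absolutely_integrable_on {a..b}"
    and zero: "\<And>x. x \<in> {a..b} \<Longrightarrow> integral {a..x} w = 0"
  shows "negligible {x \<in> {a..b}. w x \<noteq> 0}"
proof -
  define D where "D x = indicator {a..b} x *\<^sub>R w x" for x
  have D: "integrable lebesgue D"
    using w by (simp add: D_def[abs_def] set_integrable_def)
  then obtain D' where D': "D' \<in> borel_measurable lborel" "AE x in lborel. D x = D' x"
    using completion_ex_borel_measurable_real[of D lborel] by (auto dest: borel_measurable_integrable)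
  have aeL: "AE x in lebesgue. D x = D' x" using D'(2) by (rule AE_completion)
  have D'm: "D' \<in> borel_measurable lebesgue" using D'(1) by (rule measurable_completion)
  have D'i: "integrable lborel D'"
    using D integrable_cong_AE[OF borel_measurable_integrable[OF D] D'm aeL] integrable_completion[OF D'(1)] by simp
  have transfer: "(LINT x:A|lborel. D' x) = integral (A \<inter> {a..b}) w" if A: "A \<in> sets borel" for A
  proof -
    have "(LINT x:A|lborel. D' x) = (LINT x|lebesgue. indicator A x *\<^sub>R D' x)"
      unfolding set_lebesgue_integral_def using A D'(1) by (subst integral_completion) auto
    also have "\<dots> = (LINT x|lebesgue. indicator A x *\<^sub>R D x)"
    proof (rule integral_cong_AE)
      have "indicat_real A \<in> borel_measurable lebesgue"
        using A by (intro borel_measurable_indicator) simp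
      then show "(\<lambda>x. indicator A x *\<^sub>R D' x) \<in> borel_measurable lebesgue"
          "(\<lambda>x. indicator A x *\<^sub>R D x) \<in> borel_measurable lebesgue"
        using D'm borel_measurable_integrable[OF D] by (auto intro: borel_measurable_times)
      show "AE x in lebesgue. indicator A x *\<^sub>R D' x = indicator A x *\<^sub>R D x"
        using aeL by eventually_elim simp
    qed
    also have "\<dots> = (LINT x:A \<inter> {a..b}|lebesgue. w x)"
      unfolding set_lebesgue_integral_def D_def by (intro Bochner_Integration.integral_cong) (auto simp: indicator_def)
    also have "\<dots> = integral (A \<inter> {a..b}) w"
      using A by (intro set_lebesgue_integral_eq_integral set_integrable_subset[OF w]) auto
    finally show ?thesis .
  qed
  have sub: "integral {u..v} w = 0" if "a \<le> u" "u \<le> v" "v \<le> b" for u v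
  proof -
    have "w integrable_on {a..v}"
      using set_lebesgue_integral_eq_integral(1)[OF w] that by (auto intro: integrable_on_subinterval)
    then have "integral {a..u} w + integral {u..v} w = integral {a..v} w"
      using that by (intro Henstock_Kurzweil_Integration.integral_combine) auto
    then show ?thesis using zero[of u] zero[of v] that by auto
  qed
  have zeroA: "(LINT x:A|lborel. D' x) = 0" if "A \<in> sets borel" for A
    using that
  proof (induction rule: borel_set_induct)
    case empty
    show ?case by (simp add: set_lebesgue_integral_def)
  next
    case (interval u v)
    have "{u..v} \<inter> {a..b} = {max u a..min v b}" by auto
    moreover have "integral {max u a..min v b} w = 0"
      using sub[of "max u a" "min v b"] by (cases "max u a \<le> min v b") auto
    ultimately show ?case by (simp add: transfer)
  next
    case (compl A)
    have i: "set_integrable lborel B D'" if "B \<in> sets borel" for B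
      unfolding set_integrable_def by (rule integrable_mult_indicator[OF _ D'i]) (use that in auto)
    have "(LINT x:A \<union> - A|lborel. D' x) = (LINT x:A|lborel. D' x) + (LINT x:- A|lborel. D' x)"
      using compl(1) by (intro set_integral_Un i) auto
    moreover have "(LINT x:A \<union> - A|lborel. D' x) = 0"
      using sub[of a b] transfer[of UNIV] by (cases "a \<le> b") auto
    ultimately show ?case using compl by simp
  next
    case (union f)
    have "(\<Union>i. f i) \<in> sets borel" using union by auto
    then have "set_integrable lborel (\<Union>i. f i) D'"
      unfolding set_integrable_def by (intro integrable_mult_indicator[OF _ D'i]) auto
    then have "(LINT x:(\<Union>i. f i)|lborel. D' x) = (\<Sum>i. (LINT x:(f i)|lborel. D' x))"
      using union by (intro lebesgue_integral_countable_add) (auto simp: disjoint_family_on_def)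
    then show ?case using union by simp
  qed
  have "AE x in lborel. D' x = 0"
    by (rule sigma_finite_measure.density_zero[OF sigma_finite_lborel D'i]) (use zeroA in auto)
  then have "AE x in lebesgue. D' x = 0" by (rule AE_completion)
  with aeL have "AE x in lebesgue. D x = 0" by auto
  then obtain N where "negligible N" "{x. D x \<noteq> 0} \<subseteq> N"
    by (auto simp: eventually_ae_filter negligible_iff_null_sets)
  then show ?thesis
    by (elim negligible_subset) (auto simp: D_def)
qed

lemma indefinite_integral_lipschitz:
  fixes w :: "real \<Rightarrow> real"
  assumes w: "w absolutely_integrable_on {a..b}"
    and bound: "negligible {x \<in> {a..b}. \<bar>w x\<bar> > K}" and K: "K \<ge> 0"
  shows "K-lipschitz_on {a..b} (\<lambda>x. integral {a..x} w + \<alpha>)"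
proof (rule lipschitz_on_leI[OF _ K])
  fix x y assume xy: "x \<in> {a..b}" "y \<in> {a..b}" "x \<le> y"
  have i: "w integrable_on {a..b}" using set_lebesgue_integral_eq_integral(1)[OF w] .
  have "integral {a..x} w + integral {x..y} w = integral {a..y} w"
    using xy by (intro Henstock_Kurzweil_Integration.integral_combine integrable_on_subinterval[OF i]) auto
  moreover have "\<bar>integral {x..y} w\<bar> \<le> K * (y - x)"
  proof -
    define N where "N = {x \<in> {a..b}. \<bar>w x\<bar> > K}"
    define w' where "w' t = (if t \<in> N then 0 else w t)" for t
    have N: "negligible N" using bound by (simp add: N_def)
    have "w' integrable_on {x..y}"
      by (rule integrable_spike[OF integrable_on_subinterval[OF i] N]) (use xy in \<open>auto simp: w'_def\<close>)
    then have "norm (integral {x..y} w') \<le> integral {x..y} (\<lambda>_. K)"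
      by (rule integral_norm_bound_integral) (use xy K in \<open>auto simp: w'_def N_def\<close>)
    also have "integral {x..y} w' = integral {x..y} w"
      by (rule integral_spike[OF N]) (auto simp: w'_def)
    finally show ?thesis using xy by (simp add: mult.commute)
  qed
  ultimately show "dist (integral {a..x} w + \<alpha>) (integral {a..y} w + \<alpha>) \<le> K * dist x y"
    using xy by (simp add: dist_real_def)
qed

text \<open>
  Lebesgue's differentiation theorem for essentially bounded integrands: the indefinite integral is
  Lipschitz, hence is the integral of its derivative, which must therefore agree with the integrand.
\<close>

lemma negligible_deriv_indefinite_integral:
  fixes w :: "real \<Rightarrow> real"
  assumes w: "w absolutely_integrable_on {a..b}" and ab: "a \<le> b"
    and bound: "negligible {x \<in> {a..b}. \<bar>w x\<bar> > K}" and K: "K \<ge> 0"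
  shows "negligible {x \<in> {a..b}. deriv (\<lambda>x. integral {a..x} w + \<alpha>) x \<noteq> w x}"
proof -
  define g where "g x = integral {a..x} w + \<alpha>" for x
  have lip: "K-lipschitz_on {a..b} g"
    unfolding g_def by (rule indefinite_integral_lipschitz[OF w bound K])
  have "negligible {x \<in> {a..b}. deriv g x - w x \<noteq> 0}"
  proof (rule negligible_nonzero_if_integrals_zero)
    show "(\<lambda>x. deriv g x - w x) absolutely_integrable_on {a..b}"
      by (intro set_integral_diff lipschitz_has_integral_deriv(2)[OF lip ab] w)
    fix x assume x: "x \<in> {a..b}"
    have "(deriv g has_integral (g x - g a)) {a..x}"
      by (rule lipschitz_has_integral_deriv(1)[OF lipschitz_on_subset[OF lip]]) (use x in auto)
    moreover have "(w has_integral integral {a..x} w) {a..x}"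
      using set_lebesgue_integral_eq_integral(1)[OF w] x
      by (intro integrable_integral) (auto intro: integrable_on_subinterval)
    ultimately have "((\<lambda>x. deriv g x - w x) has_integral (g x - g a - integral {a..x} w)) {a..x}"
      by (rule has_integral_diff)
    then show "integral {a..x} (\<lambda>x. deriv g x - w x) = 0"
      by (simp add: integral_unique g_def)
  qed
  then show ?thesis by (simp add: g_def[abs_def])
qed

section \<open>Essentially bounded functions on the circle\<close>

lemma AE_open_interval_iff_negligible:
  "(AE x in lebesgue_on {a<..<b}. P x) \<longleftrightarrow> negligible {x \<in> {a..b::real}. \<not> P x}"
proof -
  have "(AE x in lebesgue_on {a<..<b}. P x) \<longleftrightarrow> (AE x in lebesgue. x \<in> {a<..<b} \<longrightarrow> P x)"
    by (subst AE_restrict_space_iff) auto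
  also have "\<dots> \<longleftrightarrow> negligible {x. \<not> (x \<in> {a<..<b} \<longrightarrow> P x)}"
    unfolding eventually_ae_filter_negligible by (auto intro: negligible_subset)
  also have "\<dots> \<longleftrightarrow> negligible {x \<in> {a..b}. \<not> P x}"
  proof
    assume "negligible {x. \<not> (x \<in> {a<..<b} \<longrightarrow> P x)}"
    then have "negligible ({x. \<not> (x \<in> {a<..<b} \<longrightarrow> P x)} \<union> {a, b})"
      by (rule negligible_Un) simp
    then show "negligible {x \<in> {a..b}. \<not> P x}"
      by (rule negligible_subset) (auto simp: less_le)
  qed (auto elim: negligible_subset)
  finally show ?thesis .
qed

lemma Linf_norm_leD:
  assumes "Linf_norm w \<le> ereal K"
  shows "negligible {x \<in> {0..2*pi}. \<bar>w x\<bar> > K}"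
proof -
  have "AE x in lebesgue_on {0<..<2*pi}. ereal \<bar>w x\<bar> \<le> Linf_norm w"
    unfolding Linf_norm_def by (rule esssup_AE)
  then have "AE x in lebesgue_on {0<..<2*pi}. \<bar>w x\<bar> \<le> K"
    by eventually_elim (use assms order_trans in force)
  then show ?thesis
    by (simp add: AE_open_interval_iff_negligible not_le)
qed

text \<open>
  Measurability has to be assumed here, since the essential supremum of a function that is not
  measurable is infinite by convention.
\<close>

lemma Linf_norm_leI:
  assumes "w \<in> borel_measurable (lebesgue_on {0<..<2*pi})"
    and "negligible {x \<in> {0..2*pi}. \<bar>w x\<bar> > K}"
  shows "Linf_norm w \<le> ereal K"
  unfolding Linf_norm_def
proof (rule esssup_I)
  show "(\<lambda>x. ereal \<bar>w x\<bar>) \<in> borel_measurable (lebesgue_on {0<..<2*pi})"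
    using assms(1) by simp
  show "AE x in lebesgue_on {0<..<2*pi}. ereal \<bar>w x\<bar> \<le> ereal K"
    using assms(2) AE_open_interval_iff_negligible[where P = "\<lambda>x. \<bar>w x\<bar> \<le> K"] by (simp add: not_le)
qed

lemma Linf_bounded:
  assumes "w \<in> Linf"
  shows "\<exists>K\<ge>0. negligible {x \<in> {0..2*pi}. \<bar>w x\<bar> > K}"
proof -
  have "Linf_norm w < \<infinity>" using assms by (simp add: Linf_def)
  have "\<exists>K\<ge>0. Linf_norm w \<le> ereal K"
  proof (cases "Linf_norm w")
    case (real r)
    then show ?thesis by (intro exI[of _ "max 0 r"]) auto
  qed (use \<open>Linf_norm w < \<infinity>\<close> in auto)
  then show ?thesis using Linf_norm_leD by blast
qed

lemma Linf_absolutely_integrable: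
  assumes "w \<in> Linf"
  shows "w absolutely_integrable_on {0..2*pi}"
proof -
  obtain K where K: "K \<ge> 0" "negligible {x \<in> {0..2*pi}. \<bar>w x\<bar> > K}"
    using Linf_bounded[OF assms] by blast
  define N where "N = {0, 2*pi} \<union> {x \<in> {0..2*pi}. \<bar>w x\<bar> > K}"
  have N: "negligible N" unfolding N_def using K(2) by (intro negligible_Un) auto
  \<comment> \<open>Truncation makes the essential bound hold everywhere without changing \<open>w\<close> outside \<open>N\<close>.\<close>
  define w' where "w' x = min K (max (- K) (w x))" for x
  have "w \<in> borel_measurable (lebesgue_on {0<..<2*pi})" using assms by (simp add: Linf_def)
  then have "w' \<in> borel_measurable (lebesgue_on {0<..<2*pi})"
    unfolding w'_def by measurable
  moreover have "(\<lambda>_. K) integrable_on {0<..<2*pi}"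
    by (rule integrable_on_const) simp
  ultimately have "w' absolutely_integrable_on {0<..<2*pi}"
    by (intro measurable_bounded_by_integrable_imp_absolutely_integrable[where g = "\<lambda>_. K"])
       (use K(1) in \<open>auto simp: w'_def min_def max_def\<close>)
  then have "w' absolutely_integrable_on {0..2*pi}"
    by (simp add: absolutely_integrable_on_Icc_iff_Ioo)
  then show ?thesis
    by (rule absolutely_integrable_spike[OF _ N]) (auto simp: N_def w'_def min_def max_def)
qed

section \<open>Periodic Lipschitz functions and admissible directions\<close>

lemma W1inf_perD:
  assumes "v \<in> W1inf_per"
  shows "\<exists>L. L-lipschitz_on {0..2*pi} v" "v 0 = v (2*pi)" "continuous_on {0..2*pi} v"
    "deriv v absolutely_integrable_on {0..2*pi}" "integral {0..2*pi} (deriv v) = 0"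
proof -
  obtain L where L: "L-lipschitz_on {0..2*pi} v" "v 0 = v (2*pi)"
    using assms by (auto simp: W1inf_per_def)
  then show "\<exists>L. L-lipschitz_on {0..2*pi} v" "v 0 = v (2*pi)" "continuous_on {0..2*pi} v"
      "deriv v absolutely_integrable_on {0..2*pi}" "integral {0..2*pi} (deriv v) = 0"
    using lipschitz_has_integral_deriv[OF L(1)]
    by (auto simp: lipschitz_on_continuous_on integral_unique)
qed

lemma W1inf_per_integral_by_parts:
  assumes u: "u \<in> W1inf_per" and v: "v \<in> W1inf_per"
  shows "integral {0..2*pi} (\<lambda>x. u x * deriv v x) = - integral {0..2*pi} (\<lambda>x. deriv u x * v x)"
proof -
  obtain L M where "L-lipschitz_on {0..2*pi} u" "M-lipschitz_on {0..2*pi} v"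
    using W1inf_perD(1)[OF u] W1inf_perD(1)[OF v] by blast
  from lipschitz_integral_by_parts[OF this] show ?thesis
    using W1inf_perD(2)[OF u] W1inf_perD(2)[OF v] by simp
qed

lemma shape_derivative_by_parts:
  assumes h: "h \<in> Linf" and H: "H \<in> W1inf_per" and v: "v \<in> W1inf_per"
    and eq: "AE \<phi> in lebesgue_on {0<..<2*pi}. H \<phi> = Hb \<phi>"
  shows "shape_derivative h Hb v = integral {0..2*pi} (\<lambda>\<phi>. (h \<phi> - deriv H \<phi>) * v \<phi>)"
proof -
  note hi = continuous_mult_absolutely_integrable[OF W1inf_perD(3)[OF v] Linf_absolutely_integrable[OF h]]
  note Hi = continuous_mult_absolutely_integrable[OF W1inf_perD(3)[OF H] W1inf_perD(4)[OF v]]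
  note Hi' = continuous_mult_absolutely_integrable[OF W1inf_perD(3)[OF v] W1inf_perD(4)[OF H]]
  note int = hi[THEN set_lebesgue_integral_eq_integral(1)] Hi[THEN set_lebesgue_integral_eq_integral(1)]
    Hi'[THEN set_lebesgue_integral_eq_integral(1)]
  have N: "negligible {\<phi> \<in> {0..2*pi}. H \<phi> \<noteq> Hb \<phi>}"
    using eq by (simp add: AE_open_interval_iff_negligible)
  have "(\<lambda>\<phi>. h \<phi> * v \<phi> + Hb \<phi> * deriv v \<phi>) absolutely_integrable_on {0..2*pi}"
    by (rule absolutely_integrable_spike[OF set_integral_add(1)[OF hi Hi] N]) auto
  then have "shape_derivative h Hb v = integral {0..2*pi} (\<lambda>\<phi>. h \<phi> * v \<phi> + Hb \<phi> * deriv v \<phi>)"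
    unfolding shape_derivative_def by (rule set_lebesgue_integral_eq_integral(2))
  also have "\<dots> = integral {0..2*pi} (\<lambda>\<phi>. v \<phi> * h \<phi> + H \<phi> * deriv v \<phi>)"
    by (rule integral_spike[OF N]) auto
  also have "\<dots> = integral {0..2*pi} (\<lambda>\<phi>. v \<phi> * h \<phi>) + integral {0..2*pi} (\<lambda>\<phi>. H \<phi> * deriv v \<phi>)"
    by (rule integral_add[OF int(1,2)])
  also have "\<dots> = integral {0..2*pi} (\<lambda>\<phi>. v \<phi> * h \<phi>) - integral {0..2*pi} (\<lambda>\<phi>. v \<phi> * deriv H \<phi>)"
    using W1inf_per_integral_by_parts[OF H v] by (simp add: mult.commute)
  also have "\<dots> = integral {0..2*pi} (\<lambda>\<phi>. v \<phi> * h \<phi> - v \<phi> * deriv H \<phi>)"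
    by (rule integral_diff[OF int(1,3), symmetric])
  finally show ?thesis by (simp add: algebra_simps)
qed

lemma integral_mult_eq_primitive_mult_deriv:
  assumes q: "q absolutely_integrable_on {0..2*pi}"
    and bound: "negligible {x \<in> {0..2*pi}. \<bar>q x\<bar> > K}" "0 \<le> K"
    and zero: "integral {0..2*pi} q = 0" and v: "v \<in> W1inf_per"
  shows "integral {0..2*pi} (\<lambda>\<phi>. q \<phi> * v \<phi>)
    = integral {0..2*pi} (\<lambda>\<phi>. - integral {0..\<phi>} q * deriv v \<phi>)"
proof -
  define P where "P x = integral {0..x} q + 0" for x
  have P: "P \<in> W1inf_per"
    using indefinite_integral_lipschitz[OF q bound, of 0] zero by (auto simp: W1inf_per_def P_def[abs_def])
  have "integral {0..2*pi} (\<lambda>\<phi>. q \<phi> * v \<phi>) = integral {0..2*pi} (\<lambda>\<phi>. deriv P \<phi> * v \<phi>)"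
    by (rule integral_spike[OF negligible_deriv_indefinite_integral[OF q _ bound, of 0]])
       (simp add: P_def[abs_def])+
  also have "\<dots> = - integral {0..2*pi} (\<lambda>\<phi>. P \<phi> * deriv v \<phi>)"
    using W1inf_per_integral_by_parts[OF P v] by simp
  finally show ?thesis by (simp only: P_def add_0_right mult_minus_left integral_neg)
qed

lemma V_infD:
  assumes "v \<in> V_inf f" and "continuous_on {0..2*pi} (on_angle f)"
  shows "v \<in> W1inf_per" "integral {0..2*pi} (\<lambda>x. v x * on_angle f x) = 0"
    "negligible {x \<in> {0..2*pi}. \<bar>deriv v x\<bar> > 1}"
proof -
  show v: "v \<in> W1inf_per" using assms by (simp add: V_inf_def)
  have "(\<lambda>x. on_angle f x * v x) absolutely_integrable_on {0..2*pi}"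
    by (intro absolutely_integrable_continuous_real continuous_on_mult assms W1inf_perD(3)[OF v])
  from set_lebesgue_integral_eq_integral(2)[OF this]
  show "integral {0..2*pi} (\<lambda>x. v x * on_angle f x) = 0"
    using assms(1) by (simp add: V_inf_def mult.commute)
  have "Linf_norm (deriv v) \<le> ereal 1" using assms(1) by (simp add: V_inf_def one_ereal_def)
  then show "negligible {x \<in> {0..2*pi}. \<bar>deriv v x\<bar> > 1}"
    by (rule Linf_norm_leD)
qed

lemma V_infI:
  assumes L: "1-lipschitz_on {0..2*pi} v" and per: "v 0 = v (2*pi)"
    and int: "(LINT \<phi>:{0..2*pi}|lebesgue. on_angle f \<phi> * v \<phi>) = 0"
  shows "v \<in> V_inf f"
proof -
  have "deriv v \<in> borel_measurable (lebesgue_on {0..2*pi})"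
    by (rule absolutely_integrable_imp_borel_measurable[OF lipschitz_has_integral_deriv(2)[OF L]]) auto
  then have m: "deriv v \<in> borel_measurable (lebesgue_on {0<..<2*pi})"
    by (rule measurable_restrict_mono) auto
  have "{x \<in> {0..2*pi}. \<bar>deriv v x\<bar> > 1} \<subseteq> {x \<in> {0<..<2*pi}. \<not> v differentiable (at x)} \<union> {0, 2*pi}"
    using lipschitz_abs_deriv_le[OF L] by (force simp: less_le)
  then have "negligible {x \<in> {0..2*pi}. \<bar>deriv v x\<bar> > 1}"
    by (rule negligible_subset[rotated])
       (intro negligible_Un negligible_nondifferentiable_lipschitz[OF L], simp)
  from Linf_norm_leI[OF m this] show ?thesis
    using assms by (auto simp: V_inf_def W1inf_per_def one_ereal_def)
qed

text \<open>
  The derivative of a periodic function has mean zero, so constants may be subtracted from the weight.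
\<close>

lemma integral_deriv_eq_if_zero_mean:
  assumes G: "continuous_on {0..2*pi} G" and v: "v \<in> W1inf_per"
  shows "integral {0..2*pi} (\<lambda>x. G x * deriv v x) = integral {0..2*pi} (\<lambda>x. (G x - \<beta>) * deriv v x)"
proof -
  note D = W1inf_perD(4,5)[OF v]
  have "integral {0..2*pi} (\<lambda>x. G x * deriv v x - \<beta> * deriv v x)
    = integral {0..2*pi} (\<lambda>x. G x * deriv v x) - integral {0..2*pi} (\<lambda>x. \<beta> * deriv v x)"
    using continuous_mult_absolutely_integrable[OF G D(1)] D(1)
    by (intro integral_diff integrable_on_mult_right) (auto dest: set_lebesgue_integral_eq_integral(1))
  also have "integral {0..2*pi} (\<lambda>x. \<beta> * deriv v x) = 0" using D(2) by simp
  finally show ?thesis by (simp add: algebra_simps)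
qed

section \<open>The level that halves the circle\<close>

lemma sublevel_lmeasurable:
  fixes G :: "real \<Rightarrow> real"
  assumes "continuous_on {a..b} G"
  shows "{x \<in> {a..<b}. G x < r} \<in> lmeasurable" "{x \<in> {a..<b}. G x \<le> r} \<in> lmeasurable"
proof -
  have "closed ({a..b} \<inter> G -` {r..})" "closed ({a..b} \<inter> G -` {..r})"
    by (intro continuous_closed_preimage[OF assms] closed_atLeastAtMost closed_atLeast closed_atMost)+
  then have "{a..<b} - ({a..b} \<inter> G -` {r..}) \<in> sets borel" "{a..<b} \<inter> ({a..b} \<inter> G -` {..r}) \<in> sets borel"
    by auto
  moreover have "{a..<b} - ({a..b} \<inter> G -` {r..}) = {x \<in> {a..<b}. G x < r}"
      "{a..<b} \<inter> ({a..b} \<inter> G -` {..r}) = {x \<in> {a..<b}. G x \<le> r}"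
    by auto
  ultimately have sets: "{x \<in> {a..<b}. G x < r} \<in> sets lebesgue" "{x \<in> {a..<b}. G x \<le> r} \<in> sets lebesgue"
    by auto
  have ivl: "{a..<b} \<in> lmeasurable"
    by (rule bounded_set_imp_lmeasurable) auto
  show "{x \<in> {a..<b}. G x < r} \<in> lmeasurable" "{x \<in> {a..<b}. G x \<le> r} \<in> lmeasurable"
    by (rule fmeasurableI2[OF ivl _ sets(1)], blast) (rule fmeasurableI2[OF ivl _ sets(2)], blast)
qed

text \<open>
  The level \<open>\<beta>\<close> splits the interval at mass \<open>m\<close>: the strict sublevel set is the increasing union of
  sublevel sets with \<open>r < \<beta>\<close>, and the weak one is the decreasing intersection of those with \<open>r > \<beta>\<close>.
\<close>

lemma level_measure_bounds:
  fixes G :: "real \<Rightarrow> real"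
  assumes G: "continuous_on {a..b} G" and m: "0 \<le> m" "m < b - a"
    and M: "M = (\<lambda>r. measure lebesgue {x \<in> {a..<b}. G x < r})" and \<beta>: "\<beta> = Sup {r. M r \<le> m}"
  shows "measure lebesgue {x \<in> {a..<b}. G x < \<beta>} \<le> m"
    and "m \<le> measure lebesgue {x \<in> {a..<b}. G x \<le> \<beta>}"
proof -
  note lm = sublevel_lmeasurable[OF G]
  have mono: "M r \<le> M s" if "r \<le> s" for r s
    unfolding M using that by (intro measure_mono_fmeasurable lm fmeasurableD) auto
  have "bounded (G ` {a..b})"
    by (intro compact_imp_bounded compact_continuous_image G) auto
  then obtain A where A: "\<forall>x\<in>{a..b}. \<bar>G x\<bar> \<le> A"
    by (auto simp: bounded_iff)
  have "{x \<in> {a..<b}. G x < - A} = {}" using A by (force simp: abs_le_iff)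
  then have "M (- A) = 0" unfolding M by (simp only: measure_empty)
  then have "- A \<in> {r. M r \<le> m}" using m by simp
  then have ne: "{r. M r \<le> m} \<noteq> {}" by blast
  have bdd: "bdd_above {r. M r \<le> m}"
  proof (rule bdd_aboveI)
    fix r assume r: "r \<in> {r. M r \<le> m}"
    show "r \<le> A"
    proof (rule ccontr)
      assume "\<not> r \<le> A"
      then have "{x \<in> {a..<b}. G x < r} = {a..<b}" using A by (force simp: abs_le_iff)
      then have "M r = b - a" unfolding M using m by simp
      with r m show False by simp
    qed
  qed
  \<comment> \<open>The two continuity arguments use these bounds along \<open>\<beta> - 1 / (n + 1)\<close> and \<open>\<beta> + 1 / (n + 1)\<close>.\<close>
  have below: "M r \<le> m" if r: "r < \<beta>" for r
  proof -
    obtain s where "M s \<le> m" "r < s" using less_cSupD[OF ne, of r] r \<beta> by auto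
    with mono[of r s] show ?thesis by simp
  qed
  have above: "m \<le> M r" if "r > \<beta>" for r
    using cSup_upper[OF _ bdd, of r] that \<beta> by force
  have conv: "(\<lambda>n. 1 / real (Suc n)) \<longlonglongrightarrow> 0"
    using LIMSEQ_inverse_real_of_nat by (simp add: inverse_eq_divide)
  have anti: "1 / real (Suc n') \<le> 1 / real (Suc n)" if "n \<le> n'" for n n'
    using that by (auto simp: field_simps)
  define S where "S n = {x \<in> {a..<b}. G x < \<beta> - 1 / real (Suc n)}" for n
  have MS: "measure lebesgue (S n) = M (\<beta> - 1 / real (Suc n))" for n
    unfolding M S_def ..
  have limS: "(\<lambda>n. measure lebesgue (S n)) \<longlonglongrightarrow> measure lebesgue (\<Union>n. S n)"
  proof (rule Lim_measure_incseq)
    show "range S \<subseteq> sets lebesgue" using lm(1) by (auto simp: S_def)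
    show "incseq S" using anti unfolding incseq_def S_def by force
    have "(\<Union>n. S n) \<subseteq> {a..<b}" by (auto simp: S_def)
    then have "emeasure lebesgue (\<Union>n. S n) \<le> emeasure lebesgue {a..<b}"
      by (intro emeasure_mono) auto
    also have "\<dots> = ennreal (b - a)" using m by simp
    finally show "emeasure lebesgue (\<Union>n. S n) \<noteq> \<infinity>" by (auto simp: top_unique)
  qed
  have eqS: "(\<Union>n. S n) = {x \<in> {a..<b}. G x < \<beta>}"
  proof -
    have "\<exists>n. G x < \<beta> - 1 / real (Suc n)" if "G x < \<beta>" for x
      using nat_approx_posE[of "\<beta> - G x"] that by (metis diff_gt_0_iff_gt less_diff_eq add.commute)
    moreover have "G x < \<beta>" if "G x < \<beta> - 1 / real (Suc n)" for x n
      using that by (smt (verit) divide_nonneg_nonneg of_nat_0_le_iff)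
    ultimately show ?thesis unfolding S_def by blast
  qed
  have "(\<lambda>n. M (\<beta> - 1 / real (Suc n))) \<longlonglongrightarrow> measure lebesgue {x \<in> {a..<b}. G x < \<beta>}"
    using limS unfolding eqS MS .
  then show "measure lebesgue {x \<in> {a..<b}. G x < \<beta>} \<le> m"
    by (rule LIMSEQ_le_const2) (auto intro!: below)
  define T where "T n = {x \<in> {a..<b}. G x < \<beta> + 1 / real (Suc n)}" for n
  have MT: "measure lebesgue (T n) = M (\<beta> + 1 / real (Suc n))" for n
    unfolding M T_def ..
  have limT: "(\<lambda>n. measure lebesgue (T n)) \<longlonglongrightarrow> measure lebesgue (\<Inter>n. T n)"
  proof (rule Lim_measure_decseq)
    show "range T \<subseteq> sets lebesgue" using lm(1) by (auto simp: T_def)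
    show "decseq T" using anti unfolding decseq_def T_def by force
    show "emeasure lebesgue (T n) \<noteq> \<infinity>" for n
      using fmeasurableD2[OF lm(1)] by (simp add: T_def)
  qed
  have eqT: "(\<Inter>n. T n) = {x \<in> {a..<b}. G x \<le> \<beta>}"
  proof -
    have "G x \<le> \<beta>" if "\<And>n. G x < \<beta> + 1 / real (Suc n)" for x
      using LIMSEQ_le_const[OF tendsto_add[OF tendsto_const conv], of "G x" \<beta>] that
      by (force intro: less_imp_le)
    moreover have "G x < \<beta> + 1 / real (Suc n)" if "G x \<le> \<beta>" for x n
      using that by (smt (verit) divide_pos_pos of_nat_0_less_iff zero_less_Suc)
    ultimately show ?thesis unfolding T_def by blast
  qed
  have "(\<lambda>n. M (\<beta> + 1 / real (Suc n))) \<longlonglongrightarrow> measure lebesgue {x \<in> {a..<b}. G x \<le> \<beta>}"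
    using limT unfolding eqT MT .
  then show "m \<le> measure lebesgue {x \<in> {a..<b}. G x \<le> \<beta>}"
    by (rule LIMSEQ_le_const) (auto intro!: above)
qed

section \<open>Positivity of the radius function\<close>

lemma circ_in_sphere: "circ \<phi> \<in> sphere 0 1"
  by (simp add: circ_def norm_vec_def L2_set_def UNIV_2)

lemma continuous_on_circ: "continuous_on A circ"
  unfolding circ_def
proof (rule continuous_on_vec_lambda[THEN continuous_on_eq])
  show "continuous_on A (\<lambda>\<phi>. if i = 1 then cos \<phi> else sin \<phi>)" for i :: 2
    by (cases "i = 1") (auto intro: continuous_intros)
  show "(\<chi> i. if i = 1 then cos \<phi> else sin \<phi>) = (vector [cos \<phi>, sin \<phi>] :: plane)" for \<phi>
    unfolding vec_eq_iff forall_2 by simp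
qed

lemma on_angle_continuous_positive:
  assumes f: "f \<in> W1inf_circle" "0 < (INF \<omega>\<in>sphere 0 1. f \<omega>)"
  shows "continuous_on A (on_angle f)" "0 < integral {0..2*pi} (on_angle f)"
proof -
  obtain L where L: "L-lipschitz_on (sphere 0 1) f" using f by (auto simp: W1inf_circle_def)
  have contf: "continuous_on (sphere 0 1) f" by (rule lipschitz_on_continuous_on[OF L])
  show cont: "continuous_on A (on_angle f)" for A
    unfolding on_angle_def
    by (rule continuous_on_compose2[OF contf continuous_on_circ]) (use circ_in_sphere in auto)
  define m where "m = (INF \<omega>\<in>sphere 0 1. f \<omega>)"
  have "bdd_below (f ` sphere 0 1)"
    by (intro bounded_imp_bdd_below compact_imp_bounded compact_continuous_image contf) auto
  then have "m \<le> on_angle f \<phi>" for \<phi>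
    unfolding m_def on_angle_def by (intro cINF_lower circ_in_sphere) auto
  then have "integral {0..2*pi} (\<lambda>_. m) \<le> integral {0..2*pi} (on_angle f)"
    by (intro integral_le integrable_continuous_real cont) auto
  then have "2 * pi * m \<le> integral {0..2*pi} (on_angle f)" by simp
  moreover have "0 < 2 * pi * m" using f(2) by (simp add: m_def)
  ultimately show "0 < integral {0..2*pi} (on_angle f)" by linarith
qed

section \<open>Minimality of the bang-bang direction\<close>

theorem proposition2p7:
  fixes F z f u p :: "real^2 \<Rightarrow> real"
    and Du Dp Dz :: "real^2 \<Rightarrow> real^2"
    and fb hb Hb H q G M g :: "real \<Rightarrow> real"
    and c \<beta> k \<alpha> :: real
    and Op Om Oz :: "real set"
  assumes F: "L2_loc F" and z: "H1_loc z"
    and f: "f \<in> W1inf_circle" "0 < (INF \<omega>\<in>sphere 0 1. f \<omega>)"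
    and u: "weak_solution (Omega f) F u"
    and p: "weak_solution (Omega f) (\<lambda>x. u x - z x) p"
    and Du: "weak_gradient (ball 0 1) (u \<circ> Phi f) Du"
    and Dp: "weak_gradient (ball 0 1) (p \<circ> Phi f) Dp"
    and Dz: "weak_gradient (ball 0 1) (z \<circ> Phi f) Dz"
    and fb_def: "fb = on_angle f"
    and hb_def: "hb = on_angle (radial_mean
          (h_density f (F \<circ> Phi f) (z \<circ> Phi f) (u \<circ> Phi f) Du Dp Dz))"
    and Hb_def: "Hb = (\<lambda>\<phi>. radial_mean (H_density f Du Dp) (circ \<phi>) \<bullet> tang \<phi>)"
    and hb: "hb \<in> Linf"
    (* Hb is determined only almost everywhere; H is its Lipschitz representative *)
    and H: "H \<in> W1inf_per" "AE \<phi> in lebesgue_on {0<..<2*pi}. H \<phi> = Hb \<phi>"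
    and c_def: "c = (LINT \<phi>:{0..2*pi}|lebesgue. hb \<phi>) / (LINT \<phi>:{0..2*pi}|lebesgue. fb \<phi>)"
    and q_def: "q = (\<lambda>\<phi>. hb \<phi> - deriv H \<phi> - c * fb \<phi>)"
    and G_def: "G = (\<lambda>\<phi>. - (LINT t:{0..\<phi>}|lebesgue. q t))"
    and M_def: "M = (\<lambda>r. measure lebesgue {\<phi>\<in>{0..<2*pi}. G \<phi> < r})"
    and \<beta>_def: "\<beta> = Sup {r. M r \<le> pi}"
    and Op_def: "Op = {\<phi>\<in>{0..<2*pi}. G \<phi> > \<beta>}"
    and Om_def: "Om = {\<phi>\<in>{0..<2*pi}. G \<phi> < \<beta>}"
    and Oz_def: "Oz = {\<phi>\<in>{0..<2*pi}. G \<phi> = \<beta>}"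
    and k_def: "k = (if measure lebesgue Oz = 0 then 0
               else (measure lebesgue Op - measure lebesgue Om) / measure lebesgue Oz)"
    and g_def: "g = (\<lambda>\<phi>. (LINT t:{0..\<phi>}|lebesgue.
                 indicator Om t - indicator Op t + k * indicator Oz t) + \<alpha>)"
    and \<alpha>: "(LINT \<phi>:{0..2*pi}|lebesgue. g \<phi> * fb \<phi>) = 0"
  shows "g \<in> V_inf f
    \<and> (\<forall>v\<in>V_inf f. shape_derivative hb Hb g \<le> shape_derivative hb Hb v)
    \<and> (\<forall>J'. has_gateaux_derivative (J F z) f J'
            \<and> (\<forall>v\<in>W1inf_per. J' v = shape_derivative hb Hb v)
          \<longrightarrow> (\<forall>v\<in>V_inf f. J' g \<le> J' v))"
proof -
  let ?I = "{0..2*pi}"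
  have cfb: "continuous_on A fb" for A
    unfolding fb_def by (rule on_angle_continuous_positive(1)[OF f])
  have fbpos: "0 < integral ?I fb"
    unfolding fb_def by (rule on_angle_continuous_positive(2)[OF f])
  have afb: "fb absolutely_integrable_on ?I"
    by (rule absolutely_integrable_continuous_real[OF cfb])
  note ahb = Linf_absolutely_integrable[OF hb]
  obtain L where L: "L-lipschitz_on ?I H" using W1inf_perD(1)[OF H(1)] by blast
  have L0: "0 \<le> L" by (rule lipschitz_on_nonneg[OF L])
  have aH: "deriv H absolutely_integrable_on ?I" by (rule W1inf_perD(4)[OF H(1)])
  have aq: "q absolutely_integrable_on ?I"
    unfolding q_def using ahb aH afb by (intro set_integral_diff(1)) auto
  have iq: "q integrable_on ?I" by (rule set_lebesgue_integral_eq_integral(1)[OF aq])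
  have "\<exists>K\<ge>0. negligible {x \<in> ?I. \<bar>q x\<bar> > K}"
  proof -
    obtain K where K: "K \<ge> 0" "negligible {x \<in> ?I. \<bar>hb x\<bar> > K}" using Linf_bounded[OF hb] by blast
    have "bounded (fb ` ?I)" by (intro compact_imp_bounded compact_continuous_image cfb) auto
    then obtain B where B: "B > 0" "\<forall>x\<in>?I. \<bar>fb x\<bar> \<le> B" by (auto simp: bounded_pos)
    define N where "N = {x \<in> ?I. \<bar>hb x\<bar> > K} \<union> {x \<in> {0<..<2*pi}. \<not> H differentiable (at x)} \<union> {0, 2*pi}"
    have N: "negligible N"
      unfolding N_def using K(2) negligible_nondifferentiable_lipschitz[OF L] by (intro negligible_Un) auto
    have "\<bar>q x\<bar> \<le> K + L + \<bar>c\<bar> * B" if "x \<in> ?I - N" for x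
    proof -
      have "\<bar>hb x\<bar> \<le> K" "\<bar>deriv H x\<bar> \<le> L"
        using that lipschitz_abs_deriv_le[OF L, of x] by (auto simp: N_def)
      moreover have "\<bar>c * fb x\<bar> \<le> \<bar>c\<bar> * B"
        using that B by (simp add: abs_mult mult_left_mono)
      ultimately show ?thesis unfolding q_def by linarith
    qed
    then have "{x \<in> ?I. \<bar>q x\<bar> > K + L + \<bar>c\<bar> * B} \<subseteq> N" by force
    then have "negligible {x \<in> ?I. \<bar>q x\<bar> > K + L + \<bar>c\<bar> * B}" by (rule negligible_subset[OF N])
    then show ?thesis using K(1) L0 B(1) by (intro exI[of _ "K + L + \<bar>c\<bar> * B"]) auto
  qed
  then obtain K where K: "0 \<le> K" "negligible {x \<in> ?I. \<bar>q x\<bar> > K}" by blast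
  \<comment> \<open>The constant \<open>c\<close> is chosen to give \<open>q\<close> mean zero, which makes \<open>G\<close> periodic.\<close>
  have q0: "integral ?I q = 0"
  proof -
    note i = set_lebesgue_integral_eq_integral(1)[OF ahb] set_lebesgue_integral_eq_integral(1)[OF aH]
      set_lebesgue_integral_eq_integral(1)[OF afb]
    have "integral ?I q = integral ?I hb - integral ?I (deriv H) - c * integral ?I fb"
      unfolding q_def using i by (simp add: integral_diff integrable_diff integrable_on_mult_right)
    moreover have "c * integral ?I fb = integral ?I hb"
      using fbpos by (simp add: c_def set_lebesgue_integral_eq_integral(2)[OF ahb] set_lebesgue_integral_eq_integral(2)[OF afb])
    ultimately show ?thesis using W1inf_perD(5)[OF H(1)] by simp
  qed
  have G_eq: "G x = - integral {0..x} q" if "x \<in> ?I" for x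
    unfolding G_def using that
    by (simp add: set_lebesgue_integral_eq_integral(2)[OF set_integrable_subset[OF aq]])
  have cG: "continuous_on ?I G"
  proof (rule continuous_on_eq)
    show "continuous_on ?I (\<lambda>x. - integral {0..x} q)"
      by (intro continuous_intros indefinite_integral_continuous_1 iq)
  qed (simp add: G_eq)
  \<comment> \<open>The term \<open>c * fb\<close> in \<open>q\<close> is invisible to \<open>v\<close>, by the constraint on \<open>v\<close>, and \<open>\<beta>\<close> by periodicity.\<close>
  have rep: "shape_derivative hb Hb v = integral ?I (\<lambda>x. (G x - \<beta>) * deriv v x)" if v: "v \<in> V_inf f" for v
  proof -
    note vD = V_infD[OF v cfb[unfolded fb_def], folded fb_def]
    note cv = W1inf_perD(3)[OF vD(1)]
    have i1: "(\<lambda>x. v x * (hb x - deriv H x)) integrable_on ?I"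
      using continuous_mult_absolutely_integrable[OF cv set_integral_diff(1)[OF ahb aH]]
      by (rule set_lebesgue_integral_eq_integral(1))
    have i2: "(\<lambda>x. c * (v x * fb x)) integrable_on ?I"
      by (intro integrable_continuous_real continuous_intros cv cfb)
    have "shape_derivative hb Hb v = integral ?I (\<lambda>x. (hb x - deriv H x) * v x)"
      by (rule shape_derivative_by_parts[OF hb H(1) vD(1) H(2)])
    also have "\<dots> = integral ?I (\<lambda>x. v x * (hb x - deriv H x)) - integral ?I (\<lambda>x. c * (v x * fb x))"
      using vD(2) by (simp add: mult.commute)
    also have "\<dots> = integral ?I (\<lambda>x. v x * (hb x - deriv H x) - c * (v x * fb x))"
      by (rule integral_diff[OF i1 i2, symmetric])
    also have "\<dots> = integral ?I (\<lambda>x. q x * v x)"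
      by (simp add: q_def algebra_simps)
    also have "\<dots> = integral ?I (\<lambda>x. - integral {0..x} q * deriv v x)"
      by (rule integral_mult_eq_primitive_mult_deriv[OF aq K(2,1) q0 vD(1)])
    also have "\<dots> = integral ?I (\<lambda>x. G x * deriv v x)"
      by (rule Henstock_Kurzweil_Integration.integral_cong) (simp add: G_eq)
    also have "\<dots> = integral ?I (\<lambda>x. (G x - \<beta>) * deriv v x)"
      by (rule integral_deriv_eq_if_zero_mean[OF cG vD(1)])
    finally show ?thesis .
  qed
  have lOm: "Om \<in> lmeasurable"
    unfolding Om_def by (rule sublevel_lmeasurable[OF cG])
  have lOmz: "Om \<union> Oz \<in> lmeasurable" and Omz: "Om \<union> Oz = {x \<in> {0..<2*pi}. G x \<le> \<beta>}"
  proof -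
    show "Om \<union> Oz = {x \<in> {0..<2*pi}. G x \<le> \<beta>}" by (auto simp: Om_def Oz_def)
    then show "Om \<union> Oz \<in> lmeasurable" using sublevel_lmeasurable(2)[OF cG] by simp
  qed
  have lOz: "Oz \<in> lmeasurable"
  proof -
    have "Oz = (Om \<union> Oz) - Om" by (auto simp: Om_def Oz_def)
    with fmeasurable.Diff[OF lOmz lOm] show ?thesis by simp
  qed
  have ivl: "{0..<2*pi} \<in> lmeasurable"
    by (rule bounded_set_imp_lmeasurable) auto
  have lOp: "Op \<in> lmeasurable" and total: "measure lebesgue Om + measure lebesgue Oz + measure lebesgue Op = 2 * pi"
    and mOmz: "measure lebesgue (Om \<union> Oz) = measure lebesgue Om + measure lebesgue Oz"
  proof -
    have Op: "Op = {0..<2*pi} - (Om \<union> Oz)" by (auto simp: Op_def Om_def Oz_def)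
    with fmeasurable.Diff[OF ivl lOmz] show lOp: "Op \<in> lmeasurable" by simp
    show mOmz: "measure lebesgue (Om \<union> Oz) = measure lebesgue Om + measure lebesgue Oz"
      
    proof (rule measure_Union)
      show "Om \<inter> Oz = {}" by (auto simp: Om_def Oz_def)
    qed (use lOm lOz in \<open>auto simp: fmeasurable_def\<close>)
    have "measure lebesgue ((Om \<union> Oz) \<union> Op) = measure lebesgue (Om \<union> Oz) + measure lebesgue Op"
      
    proof (rule measure_Union)
      show "(Om \<union> Oz) \<inter> Op = {}" by (auto simp: Op)
    qed (use lOmz lOp in \<open>auto simp: fmeasurable_def\<close>)
    moreover have "(Om \<union> Oz) \<union> Op = {0..<2*pi}" by (auto simp: Op_def Om_def Oz_def)
    ultimately show "measure lebesgue Om + measure lebesgue Oz + measure lebesgue Op = 2 * pi"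
      using mOmz by simp
  qed
  have half: "measure lebesgue Om \<le> pi" "measure lebesgue Op \<le> pi"
  proof -
    note lb = level_measure_bounds[OF cG _ _ M_def \<beta>_def]
    show "measure lebesgue Om \<le> pi" unfolding Om_def by (rule lb(1)) auto
    have "pi \<le> measure lebesgue (Om \<union> Oz)" unfolding Omz by (rule lb(2)) auto
    with total mOmz show "measure lebesgue Op \<le> pi" by linarith
  qed
  \<comment> \<open>Since neither \<open>Om\<close> nor \<open>Op\<close> fills more than half the circle, \<open>Oz\<close> can absorb their imbalance.\<close>
  have k1: "\<bar>k\<bar> \<le> 1"
  proof (cases "measure lebesgue Oz = 0")
    case False
    then have pos: "measure lebesgue Oz > 0" using measure_nonneg[of lebesgue Oz] by linarith
    have "\<bar>measure lebesgue Op - measure lebesgue Om\<bar> \<le> measure lebesgue Oz" using total half by linarith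
    with pos False show ?thesis by (simp add: k_def abs_divide)
  qed (simp add: k_def)
  \<comment> \<open>If \<open>Oz\<close> is null, both of the other sets have measure exactly \<open>pi\<close>.\<close>
  have balance: "measure lebesgue Om - measure lebesgue Op + k * measure lebesgue Oz = 0"
    using total half by (auto simp: k_def)
  define w where "w = (\<lambda>t. indicat_real Om t - indicat_real Op t + k * indicat_real Oz t)"
  have sub: "Om \<subseteq> ?I" "Op \<subseteq> ?I" "Oz \<subseteq> ?I" by (auto simp: Om_def Op_def Oz_def)
  have ind: "indicat_real S absolutely_integrable_on ?I" "integral ?I (indicat_real S) = measure lebesgue S"
    if S: "S \<in> lmeasurable" "S \<subseteq> ?I" for S
  proof -
    have "S \<inter> ?I = S" using S by auto
    then show "integral ?I (indicat_real S) = measure lebesgue S"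
      using S by (simp add: integral_indicator)
    have "indicat_real S integrable_on ?I"
      using S \<open>S \<inter> ?I = S\<close> by (simp add: integrable_on_indicator)
    then show "indicat_real S absolutely_integrable_on ?I"
      by (intro nonnegative_absolutely_integrable_1) auto
  qed
  note iOm = ind[OF lOm sub(1)] and iOp = ind[OF lOp sub(2)] and iOz = ind[OF lOz sub(3)]
  have aw: "w absolutely_integrable_on ?I"
    unfolding w_def using iOm iOp iOz by (intro set_integral_add(1) set_integral_diff(1)) auto
  have w1: "\<bar>w x\<bar> \<le> 1" for x
    using k1 by (auto simp: w_def Om_def Op_def Oz_def indicator_def)
  then have wneg: "negligible {x \<in> ?I. \<bar>w x\<bar> > 1}"
    by (simp add: not_less[symmetric] leD)
  have w0: "integral ?I w = 0"
  proof -
    note i = iOm(1)[THEN set_lebesgue_integral_eq_integral(1)] iOp(1)[THEN set_lebesgue_integral_eq_integral(1)]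
      iOz(1)[THEN set_lebesgue_integral_eq_integral(1)]
    have "integral ?I w = measure lebesgue Om - measure lebesgue Op + k * measure lebesgue Oz"
      unfolding w_def using i iOm(2) iOp(2) iOz(2)
      by (simp add: integral_diff integral_add integrable_diff integrable_on_mult_right)
    with balance show ?thesis by simp
  qed
  define g' where "g' = (\<lambda>x. integral {0..x} w + \<alpha>)"
  have g_eq: "g x = g' x" if "x \<in> ?I" for x
    unfolding g_def g'_def w_def[symmetric] using that
    by (simp add: set_lebesgue_integral_eq_integral(2)[OF set_integrable_subset[OF aw]] w_def[symmetric])
  have lipg: "1-lipschitz_on ?I g"
  proof (rule lipschitz_on_transform)
    show "1-lipschitz_on ?I g'"
      unfolding g'_def by (rule indefinite_integral_lipschitz[OF aw wneg]) simp
  qed (simp add: g_eq)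
  have g_in: "g \<in> V_inf f"
  proof (rule V_infI[OF lipg])
    show "g 0 = g (2*pi)" using w0 by (simp add: g_eq g'_def)
    show "(LINT \<phi>:?I|lebesgue. on_angle f \<phi> * g \<phi>) = 0"
      using \<alpha> by (simp add: fb_def mult.commute)
  qed
  have dg: "negligible {x \<in> ?I. deriv g x \<noteq> w x}"
  proof -
    have "deriv g x = deriv g' x" if "x \<in> {0<..<2*pi}" for x
    proof (rule deriv_cong_ev)
      show "\<forall>\<^sub>F y in nhds x. g y = g' y"
        using that unfolding eventually_nhds by (intro exI[of _ "{0<..<2*pi}"]) (auto simp: g_eq)
    qed simp
    then have "{x \<in> ?I. deriv g x \<noteq> w x} \<subseteq> {x \<in> ?I. deriv g' x \<noteq> w x} \<union> {0, 2*pi}"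
      by (force simp: less_le)
    moreover have "negligible ({x \<in> ?I. deriv g' x \<noteq> w x} \<union> {0, 2*pi})"
      unfolding g'_def by (intro negligible_Un negligible_deriv_indefinite_integral[OF aw _ wneg]) auto
    ultimately show ?thesis by (rule negligible_subset[rotated])
  qed
  have iabs: "(\<lambda>x. - \<bar>G x - \<beta>\<bar>) integrable_on ?I"
    by (intro integrable_continuous_real continuous_intros cG)
  \<comment> \<open>By construction \<open>w\<close> is \<open>- sgn (G - \<beta>)\<close> wherever \<open>G\<close> differs from \<open>\<beta>\<close>.\<close>
  have g_val: "shape_derivative hb Hb g = integral ?I (\<lambda>x. - \<bar>G x - \<beta>\<bar>)"
    unfolding rep[OF g_in]
  proof (rule integral_spike)
    show "negligible ({x \<in> ?I. deriv g x \<noteq> w x} \<union> {2*pi})" using dg by (rule negligible_Un) simp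
    show "- \<bar>G x - \<beta>\<bar> = (G x - \<beta>) * deriv g x" if "x \<in> ?I - ({x \<in> ?I. deriv g x \<noteq> w x} \<union> {2*pi})" for x
    proof -
      have x: "x \<in> {0..<2*pi}" "deriv g x = w x" using that by (auto simp: less_le)
      show ?thesis
        using x(1) unfolding x(2) w_def by (auto simp: Om_def Op_def Oz_def indicator_def)
    qed
  qed
  have min: "shape_derivative hb Hb g \<le> shape_derivative hb Hb v" if v: "v \<in> V_inf f" for v
  proof -
    note vD = V_infD[OF v cfb[unfolded fb_def], folded fb_def]
    have "(\<lambda>x. (G x - \<beta>) * deriv v x) integrable_on ?I"
      by (rule set_lebesgue_integral_eq_integral(1)[OF continuous_mult_absolutely_integrable[OF _ W1inf_perD(4)[OF vD(1)]]])
         (intro continuous_intros cG)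
    moreover have "- \<bar>G x - \<beta>\<bar> \<le> (G x - \<beta>) * deriv v x" if "x \<in> ?I - {x \<in> ?I. \<bar>deriv v x\<bar> > 1}" for x
    proof -
      have "\<bar>(G x - \<beta>) * deriv v x\<bar> \<le> \<bar>G x - \<beta>\<bar> * 1"
        using that unfolding abs_mult by (intro mult_left_mono) auto
      then show ?thesis by (metis abs_le_iff minus_le_iff mult.right_neutral)
    qed
    ultimately show ?thesis
      unfolding g_val rep[OF v] using iabs vD(3) by (intro integral_le_negligible)
  qed
  show ?thesis
    using g_in min by (auto simp: V_inf_def)
qed

end
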